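(* Let $n>2$. A couple of rational functions $A,F$ is a good solution of $$A\circ\frac12\left(z^n+\frac1{z^n}\right)=\frac12\left(z^n+\frac1{z^n}\right)\circ F$$ if and only if $F=\varepsilon z^rR(z^n)$ and $$A=\frac{\varepsilon^n}{2}\left(z^rR(z)^n\circ\left(z+\sqrt{z^2-1}\right)+z^rR(z)^n\circ\left(z-\sqrt{z^2-1}\right)\right),$$ where $R\in\mathfrak T$, $r$ is an integer with $\gcd(r,n)=1$, and $\varepsilon^{2n}=1$. In particular, if $\mathcal O$ is the orbifold on $\mathbb{CP}^1$ defined by $\nu(-1)=2$, $\nu(1)=2$, $\nu(\infty)=n$ (and $\nu(z)=1$ at all other points), then any minimal holomorphic map $A:\mathcal O\to\mathcal O$ has the form $A=\frac{\varepsilon^n}{2}\left(z^rR(z)^n\circ\left(z+\sqrt{z^2-1}\right)+z^rR(z)^n\circ\left(z-\sqrt{z^2-1}\right)\right)$ for some $R\in\mathfrak T$, some integer $r$ with $\gcd(r,n)=1$, and some $\varepsilon$ with $\varepsilon^{2n}=1$.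
   Context: $\mathfrak T$ denotes the set of rational functions $G$ commuting with the involution $\beta:z\mapsto 1/z$, i.e. $G(1/z)=1/G(z)$. The expression $z^rR(z)^n\circ w$ means $w^rR(w)^n$; the displayed formula for $A$ defines a rational function of $z$ since it is symmetric in the two branches of $\sqrt{z^2-1}$. All rational functions considered as maps in the equation are nonconstant. Rational functions $f,p,g,q$ with $f\circ p=g\circ q$ form a good solution of this equation if the fiber product $\{(x,y)\in\mathbb{CP}^1\times\mathbb{CP}^1: f(x)=g(y)\}$ has a unique component (equivalently, the algebraic curve $f(x)-g(y)=0$ is irreducible) and $p,q$ have no non-trivial common compositional right factor, i.e. $p=\tilde p\circ w$, $q=\tilde q\circ w$ with rational $\tilde p,\tilde q,w$ implies $\deg w=1$. The couple $A,F$ is a good solution of the equation $A\circ\frac12\left(z^n+\frac1{z^n}\right)=\frac12\left(z^n+\frac1{z^n}\right)\circ F$ if $f=A$, $p=g=\frac12(z^n+z^{-n})$, $q=F$ is a good solution in this sense. For an orbifold on $\mathbb{CP}^1$ with ramification function $\nu$ (a function $\mathbb{CP}^1\to\mathbb N$ equal to $1$ outside a finite set), a rational function $A$ is a minimal holomorphic map $A:\mathcal O\to\mathcal O$ if $\nu(A(z))=\nu(z)\gcd(\deg_zA,\nu(A(z)))$ for all $z\in\mathbb{CP}^1$, where $\deg_zA$ is the local degree. *)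

theory Defs
  imports "HOL-Analysis.Analysis" "HOL-Computational_Algebra.Computational_Algebra"
    "HOL-Computational_Algebra.Field_as_Ring"
begin

section \<open>Rational functions and the maps of the Riemann sphere they induce\<close>

datatype cp1 = Finite complex | Infty

text \<open>
  A rational function is an element of the field of fractions of the polynomial ring.
  The constant map with value infinity is therefore not a rational function.
\<close>

type_synonym ratfun = "complex poly fract"

text \<open>The representation in lowest terms; the denominator is nonzero (and monic).\<close>

definition rat_num :: "ratfun \<Rightarrow> complex poly" where
  "rat_num f = fst (quot_of_fract f)"

definition rat_den :: "ratfun \<Rightarrow> complex poly" where
  "rat_den f = snd (quot_of_fract f)"

definition rat_degree :: "ratfun \<Rightarrow> nat" where
  "rat_degree f = max (degree (rat_num f)) (degree (rat_den f))"

definition nonconstant :: "ratfun \<Rightarrow> bool" where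
  "nonconstant f \<longleftrightarrow> rat_degree f > 0"

text \<open>Evaluation at a complex number. The value at a pole is the junk value 0.\<close>

definition rat_eval :: "ratfun \<Rightarrow> complex \<Rightarrow> complex" where
  "rat_eval f z = poly (rat_num f) z / poly (rat_den f) z"

text \<open>
  In the last case the value is the ratio of the coefficients of degree \<^term>\<open>degree (rat_den f)\<close>;
  it is 0 if the degree of the numerator is smaller.
\<close>

fun rat_map :: "ratfun \<Rightarrow> cp1 \<Rightarrow> cp1" where
  "rat_map f (Finite z) = (if poly (rat_den f) z = 0 then Infty else Finite (rat_eval f z))"
| "rat_map f Infty =
     (if degree (rat_num f) > degree (rat_den f) then Infty
      else Finite (coeff (rat_num f) (degree (rat_den f)) / lead_coeff (rat_den f)))"

text \<open>
  \<open>represents f h\<close>: the rational function \<open>f\<close> is the one given by the expression \<open>h\<close>. Finitely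
  many points are exempt, because \<open>h\<close> has no meaningful value at the poles of the rational
  functions it is built from. At most one \<open>f\<close> is represented by a given \<open>h\<close>, see below.
\<close>

definition represents :: "ratfun \<Rightarrow> (complex \<Rightarrow> complex) \<Rightarrow> bool" where
  "represents f h \<longleftrightarrow> (\<forall>\<^sub>F z in cofinite. rat_map f (Finite z) = Finite (h z))"

lemma rat_den_nonzero: "rat_den f \<noteq> 0"
  by (simp add: rat_den_def)

lemma Fract_rat_num_den: "Fraction_Field.Fract (rat_num f) (rat_den f) = f"
  by (simp add: rat_num_def rat_den_def)

lemma represents_unique:
  assumes "represents f h" and "represents g h"
  shows "f = g"
proof -
  let ?P = "rat_num f * rat_den g - rat_num g * rat_den f"
  have "\<forall>\<^sub>F z in cofinite. rat_map f (Finite z) = Finite (h z) \<and> rat_map g (Finite z) = Finite (h z)"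
    using assms unfolding represents_def by (rule eventually_conj)
  then have "\<forall>\<^sub>F z in cofinite. poly ?P z = 0"
    by (rule eventually_mono) (auto simp: rat_eval_def field_simps split: if_splits)
  then have fin: "finite {z. poly ?P z \<noteq> 0}"
    by (simp add: eventually_cofinite)
  have "?P = 0"
  proof (rule ccontr)
    assume "?P \<noteq> 0"
    then have "finite {z. poly ?P z = 0}"
      by (rule poly_roots_finite)
    with fin have "finite ({z. poly ?P z = 0} \<union> {z. poly ?P z \<noteq> 0})"
      by blast
    moreover have "{z. poly ?P z = 0} \<union> {z. poly ?P z \<noteq> 0} = UNIV"
      by blast
    ultimately show False
      using infinite_UNIV_char_0[where 'a = complex] by metis
  qed
  then have "Fraction_Field.Fract (rat_num f) (rat_den f) = Fraction_Field.Fract (rat_num g) (rat_den g)"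
    by (simp add: eq_fract rat_den_nonzero)
  then show ?thesis
    by (simp add: Fract_rat_num_den)
qed


section \<open>Local degree and minimal holomorphic maps between orbifolds\<close>

text \<open>The polynomial whose roots are the finite points of the fibre over a given point.\<close>

fun fibre_poly :: "ratfun \<Rightarrow> cp1 \<Rightarrow> complex poly" where
  "fibre_poly f (Finite c) = rat_num f - smult c (rat_den f)"
| "fibre_poly f Infty = rat_den f"

text \<open>
  The polynomial of a fibre, homogenised to degree \<^term>\<open>rat_degree f\<close>, vanishes at infinity to
  the order \<open>rat_degree f - degree (fibre_poly f v)\<close>. Only meaningful for nonconstant \<open>f\<close>.
\<close>

fun local_degree :: "ratfun \<Rightarrow> cp1 \<Rightarrow> nat" where
  "local_degree f (Finite z) = order z (fibre_poly f (rat_map f (Finite z)))"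
| "local_degree f Infty = rat_degree f - degree (fibre_poly f (rat_map f Infty))"

text \<open>
  An orbifold is given by its ramification function. A minimal holomorphic map is nonconstant,
  since the local degree of a constant map is undefined.
\<close>

definition minimal_holomorphic_self_map :: "(cp1 \<Rightarrow> nat) \<Rightarrow> ratfun \<Rightarrow> bool" where
  "minimal_holomorphic_self_map \<nu> A \<longleftrightarrow>
     nonconstant A \<and>
     (\<forall>z. \<nu> (rat_map A z) = \<nu> z * gcd (local_degree A z) (\<nu> (rat_map A z)))"

definition dihedral_orbifold :: "nat \<Rightarrow> cp1 \<Rightarrow> nat" where
  "dihedral_orbifold n z =
     (if z = Finite (- 1) \<or> z = Finite 1 then 2 else if z = Infty then n else 1)"


section \<open>Good solutions\<close>

text \<open>
  The numerator of \<open>f(x) - g(y)\<close> as an element of \<open>C[x][y]\<close>: the inner variable is \<open>x\<close>.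
\<close>

definition curve_poly :: "ratfun \<Rightarrow> ratfun \<Rightarrow> complex poly poly" where
  "curve_poly f g =
     smult (rat_num f) (map_poly (\<lambda>c. [:c:]) (rat_den g)) - smult (rat_den f) (map_poly (\<lambda>c. [:c:]) (rat_num g))"

lemma poly_curve_poly:
  "poly (poly (curve_poly f g) [:y:]) x
     = poly (rat_num f) x * poly (rat_den g) y - poly (rat_den f) x * poly (rat_num g) y"
proof -
  have "poly (map_poly (\<lambda>c. [:c:]) q) [:y:] = [:poly q y:]" for q :: "complex poly"
    by (induction q) (simp_all add: map_poly_pCons)
  then show ?thesis
    by (simp add: curve_poly_def)
qed

definition irreducible_curve :: "ratfun \<Rightarrow> ratfun \<Rightarrow> bool" where
  "irreducible_curve f g \<longleftrightarrow> irreducible (curve_poly f g)"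

definition no_common_right_factor :: "ratfun \<Rightarrow> ratfun \<Rightarrow> bool" where
  "no_common_right_factor p q \<longleftrightarrow>
     (\<forall>p' q' w. rat_map p = rat_map p' \<circ> rat_map w \<and> rat_map q = rat_map q' \<circ> rat_map w
        \<longrightarrow> rat_degree w = 1)"

definition good_solution :: "ratfun \<Rightarrow> ratfun \<Rightarrow> ratfun \<Rightarrow> ratfun \<Rightarrow> bool" where
  "good_solution f p g q \<longleftrightarrow>
     nonconstant f \<and> nonconstant p \<and> nonconstant g \<and> nonconstant q \<and>
     rat_map f \<circ> rat_map p = rat_map g \<circ> rat_map q \<and>
     irreducible_curve f g \<and> no_common_right_factor p q"


section \<open>The functions in the classification\<close>

abbreviation ratX :: ratfun where
  "ratX \<equiv> Fraction_Field.Fract [:0, 1:] 1"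

definition half_sum_power :: "nat \<Rightarrow> ratfun" where
  "half_sum_power n = (ratX ^ n + 1 / ratX ^ n) / 2"

fun inversion :: "cp1 \<Rightarrow> cp1" where
  "inversion (Finite z) = (if z = 0 then Infty else Finite (1 / z))"
| "inversion Infty = Finite 0"

definition commuting_with_inversion :: "ratfun set" where
  "commuting_with_inversion = {G. rat_map G \<circ> inversion = inversion \<circ> rat_map G}"

text \<open>\<open>F = \<epsilon> z\<^sup>r R(z\<^sup>n)\<close>\<close>

definition F_form :: "nat \<Rightarrow> complex \<Rightarrow> int \<Rightarrow> ratfun \<Rightarrow> ratfun \<Rightarrow> bool" where
  "F_form n \<epsilon> r R F \<longleftrightarrow> represents F (\<lambda>z. \<epsilon> * z powi r * rat_eval R (z ^ n))"

text \<open>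
  The expression is symmetric in the two square roots of \<open>z\<^sup>2 - 1\<close>, so nothing depends
  on the choice of the branch \<^term>\<open>csqrt\<close>.
\<close>

definition A_form :: "nat \<Rightarrow> complex \<Rightarrow> int \<Rightarrow> ratfun \<Rightarrow> ratfun \<Rightarrow> bool" where
  "A_form n \<epsilon> r R A \<longleftrightarrow>
     (let \<Phi> = (\<lambda>w. w powi r * rat_eval R w ^ n)
      in represents A
           (\<lambda>z. \<epsilon> ^ n / 2 * (\<Phi> (z + csqrt (z\<^sup>2 - 1)) + \<Phi> (z - csqrt (z\<^sup>2 - 1)))))"

end

theory Submission
  imports Defs
begin

text \<open>
  Write \<open>J(s) = (s + 1/s)/2\<close>, so that \<open>P = half_sum_power n\<close> is \<open>J \<circ> z\<^sup>n\<close>. The map \<open>P\<close> is the quotient of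
  the sphere by the dihedral group of the \<open>2n\<close> maps \<open>t \<mapsto> \<omega> t\<close> and \<open>t \<mapsto> \<omega>/t\<close> with \<open>\<omega>\<^sup>n = 1\<close>: two points
  have the same image exactly if the group moves one to the other. If \<open>A \<circ> P = P \<circ> F\<close>, then
  \<open>F \<circ> \<sigma>\<close> and \<open>F\<close> have the same composition with \<open>P\<close> for every \<open>\<sigma>\<close> in the group, hence
  \<open>F \<circ> \<sigma> = \<phi>(\<sigma>) \<circ> F\<close> for an endomorphism \<open>\<phi>\<close> of the group.

  Suppose that \<open>P\<close> and \<open>F\<close> have no common right factor. If \<open>\<phi>\<close> killed a rotation of order
  \<open>m > 1\<close>, both maps would factor through \<open>t\<^sup>m\<close>
  (\<open>no_common_right_factor_imp_not_rotation_invariant\<close>). So \<open>\<phi>\<close> is injective on rotations, and since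
  \<open>n > 2\<close> it cannot send a generating rotation \<open>\<zeta>\<close> to one of the involutions \<open>t \<mapsto> c/t\<close>, as \<open>\<zeta>\<^sup>2\<close> would
  then be killed. Therefore \<open>F(\<zeta> t) = \<zeta>\<^sup>k F(t)\<close> with \<open>gcd(k, n) = 1\<close> (\<open>good_solution_rotation\<close>), which
  gives \<open>F = t\<^sup>k R\<^sub>0(t\<^sup>n)\<close>.

  With \<open>s = t\<^sup>n\<close> the equation becomes \<open>A(J(s)) = J(s\<^sup>k R\<^sub>0(s)\<^sup>n)\<close>. The left side does not change under
  \<open>s \<mapsto> 1/s\<close>, so \<open>X(s) = s\<^sup>k R\<^sub>0(s)\<^sup>n\<close> satisfies \<open>X(1/s) = X(s)\<close> or \<open>X(1/s) = 1/X(s)\<close>. The first would make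
  \<open>s\<^sup>2\<^sup>k\<close> an \<open>n\<close>-th power, although \<open>n\<close> does not divide \<open>2k\<close>. The second says that \<open>R\<^sub>0(s) R\<^sub>0(1/s)\<close> is an \<open>n\<close>-th root of
  unity \<open>\<mu>\<close>, and dividing \<open>R\<^sub>0\<close> by \<open>\<epsilon> = \<surd>\<mu>\<close> gives a function commuting with the inversion
  (\<open>joukowski_lift_classification\<close>). The displayed formula for \<open>A\<close> is the equation
  \<open>A \<circ> J = J \<circ> \<epsilon>\<^sup>n s\<^sup>r R(s)\<^sup>n\<close>, since \<open>z \<plusminus> \<surd>(z\<^sup>2 - 1)\<close> are the two preimages of \<open>z\<close> under \<open>J\<close>
  (\<open>A_form_iff\<close>).

  Conversely, for \<open>F\<close> and \<open>A\<close> of the stated form \<open>F\<close> is equivariant for the automorphism with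
  \<open>\<omega> \<mapsto> \<omega>\<^sup>r\<close>, and for generic \<open>t\<close> it is injective on the orbit of \<open>t\<close>. Injectivity excludes common right
  factors, because two distinct points with equal image under a common factor lie in one orbit and
  have equal image under \<open>F\<close>. It also gives irreducibility: a factor of the polynomial of the curve
  \<open>A(x) = P(y)\<close> that vanishes along \<open>t \<mapsto> (P(t), F(t))\<close> has \<open>2n\<close> distinct roots \<open>y\<close> over a generic \<open>x\<close>,
  so the cofactor does not contain \<open>y\<close>, and then it divides the coprime numerator and
  denominator of \<open>A\<close> (\<open>curve_irreducible\<close>).

  For a minimal holomorphic map \<open>A\<close> of the orbifold, the condition at infinity gives \<open>A(\<infinity>) = \<infinity>\<close> with
  local degree \<open>k\<close> coprime to \<open>n\<close>, and the conditions at the other points say that, after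
  composition with \<open>J\<close> and up to powers of \<open>s\<close>, the functions with zeros over \<open>1\<close> and over \<open>-1\<close> are squares
  \<open>a\<^sup>2\<close>, \<open>b\<^sup>2\<close>, and the denominator is an \<open>n\<close>-th power. Factoring \<open>b\<^sup>2 - a\<^sup>2 = (b - a)(b + a)\<close> into coprime
  parts yields \<open>b - a = v\<^sup>n\<close> and \<open>b + a = s\<^sup>k u\<^sup>n\<close>, hence again \<open>A(J(s)) = J(s\<^sup>k (u/v)\<^sup>n)\<close>
  (\<open>minimal_map_lift\<close>).

  Identities between rational functions are proved at all but finitely many points; the
  field structure then turns a vanishing product into a vanishing factor, and
  \<open>ex_rat_map_comp\<close> recovers identities on the whole sphere, including infinity.
\<close>


section \<open>Rational maps in homogeneous coordinates\<close>

lemma coprime_rat_num_den: "coprime (rat_num f) (rat_den f)"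
  unfolding rat_num_def rat_den_def by (rule coprime_quot_of_fract)

lemma no_common_zero_rat_num_den: "poly (rat_num f) z \<noteq> 0 \<or> poly (rat_den f) z \<noteq> 0"
  using coprime_poly_0[OF coprime_rat_num_den[of f]] by blast

lemma coprime_if_no_common_zero:
  fixes p q :: "complex poly"
  assumes "\<And>z. poly p z \<noteq> 0 \<or> poly q z \<noteq> 0"
  shows "coprime p q"
proof (rule coprimeI)
  fix c assume c: "c dvd p" "c dvd q"
  have "\<not> poly c z = 0" for z
    using assms[of z] c by (metis dvd_trans poly_eq_0_iff_dvd)
  then have "degree c = 0"
    using fundamental_theorem_of_algebra_alt[of c] alg_closed_imp_poly_has_root[of c] by auto
  moreover have "c \<noteq> 0" using assms[of 0] c by auto
  ultimately show "is_unit c" by (simp add: is_unit_iff_degree)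
qed

text \<open>
  Two representations by coprime pairs differ by a unit of the polynomial ring. Hence the numerator
  and the denominator can be read off from any coprime pair, up to a constant.
\<close>

lemma rat_num_den_Fract:
  assumes "coprime p q" "q \<noteq> 0"
  obtains c where "c \<noteq> 0" "rat_num (Fraction_Field.Fract p q) = smult c p"
    "rat_den (Fraction_Field.Fract p q) = smult c q"
proof -
  let ?f = "Fraction_Field.Fract p q"
  let ?N = "rat_num ?f" and ?D = "rat_den ?f"
  have "Fraction_Field.Fract ?N ?D = ?f" by (rule Fract_rat_num_den)
  then have eq: "?N * q = p * ?D"
    using assms(2) by (simp add: eq_fract rat_den_nonzero)
  have "?D dvd q"
    using coprime_rat_num_den[of ?f] eq
    by (metis coprime_commute coprime_dvd_mult_right_iff dvd_triv_right)
  then obtain k where k: "q = ?D * k" by (elim dvdE)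
  have "q dvd ?D"
    using assms(1) eq by (metis coprime_commute coprime_dvd_mult_right_iff dvd_triv_right)
  then obtain l where l: "?D = q * l" by (elim dvdE)
  have "q * (l * k) = q * 1" using k l by (metis mult.assoc mult.right_neutral)
  then have "l * k = 1" using assms(2) by (simp only: mult_cancel_left) simp
  then have "is_unit l" by (metis dvd_triv_left)
  moreover from this obtain c where c: "l = [:c:]"
    by (auto simp: is_unit_poly_iff)
  ultimately have c: "l = [:c:]" "c \<noteq> 0" by auto
  have D: "?D = smult c q" using l c by simp
  have "?N * q = smult c p * q" using eq D by (simp add: mult.commute)
  then have "?N = smult c p" using assms(2) mult_right_cancel by blast
  then show ?thesis using that c D by blast
qed

text \<open>
  The point with homogeneous coordinates \<open>[a : b]\<close>, for \<open>(a, b) \<noteq> (0, 0)\<close>.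
\<close>

definition cp1_point :: "complex \<Rightarrow> complex \<Rightarrow> cp1" where
  "cp1_point a b = (if b = 0 then Infty else Finite (a / b))"

lemma cp1_point_scale: "c \<noteq> 0 \<Longrightarrow> cp1_point (c * a) (c * b) = cp1_point a b"
  by (simp add: cp1_point_def)

lemma rat_map_Finite_cp1_point: "rat_map f (Finite z) = cp1_point (poly (rat_num f) z) (poly (rat_den f) z)"
  by (simp add: cp1_point_def rat_eval_def)

lemma rat_map_Infty_cp1_point:
  "rat_map f Infty = cp1_point (coeff (rat_num f) (rat_degree f)) (coeff (rat_den f) (rat_degree f))"
proof (cases "degree (rat_num f) > degree (rat_den f)")
  case True
  then show ?thesis by (simp add: cp1_point_def rat_degree_def coeff_eq_0)
next
  case False
  then have "rat_degree f = degree (rat_den f)" by (simp add: rat_degree_def)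
  then show ?thesis using False by (simp add: cp1_point_def rat_den_nonzero)
qed

lemma rat_map_Fract_Finite:
  assumes "coprime p q" "q \<noteq> 0"
  shows "rat_map (Fraction_Field.Fract p q) (Finite z) = cp1_point (poly p z) (poly q z)"
proof -
  obtain c where c: "c \<noteq> 0" "rat_num (Fraction_Field.Fract p q) = smult c p"
    "rat_den (Fraction_Field.Fract p q) = smult c q"
    using rat_num_den_Fract[OF assms] .
  show ?thesis unfolding rat_map_Finite_cp1_point c(2,3) using c(1) by (simp add: cp1_point_scale)
qed

lemma rat_map_Fract_Infty:
  assumes "coprime p q" "q \<noteq> 0" and "degree p \<le> m" "degree q \<le> m"
    and "coeff p m \<noteq> 0 \<or> coeff q m \<noteq> 0"
  shows "rat_map (Fraction_Field.Fract p q) Infty = cp1_point (coeff p m) (coeff q m)"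
proof -
  obtain c where c: "c \<noteq> 0" "rat_num (Fraction_Field.Fract p q) = smult c p"
    "rat_den (Fraction_Field.Fract p q) = smult c q"
    using rat_num_den_Fract[OF assms(1,2)] .
  have "rat_degree (Fraction_Field.Fract p q) = m"
    using assms(3-5) le_degree[of p m] le_degree[of q m] c unfolding rat_degree_def by auto
  then show ?thesis unfolding rat_map_Infty_cp1_point c(2,3) using c(1) by (simp add: cp1_point_scale)
qed

text \<open>
  The homogenisation of \<open>p\<close> to degree \<open>d\<close>. It evaluates a polynomial at infinity
  (\<open>b = 0\<close>) on the same footing as at finite points.
\<close>

definition hom_eval :: "nat \<Rightarrow> 'a::comm_ring_1 poly \<Rightarrow> 'a \<Rightarrow> 'a \<Rightarrow> 'a" where
  "hom_eval d p a b = (\<Sum>i\<le>d. coeff p i * a ^ i * b ^ (d - i))"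

lemma hom_eval_nonzero:
  fixes a b :: complex
  assumes "degree p \<le> d" "b \<noteq> 0"
  shows "hom_eval d p a b = b ^ d * poly p (a / b)"
proof -
  have "poly p (a / b) = (\<Sum>i\<le>d. coeff p i * (a / b) ^ i)"
    unfolding poly_altdef using assms(1)
    by (intro sum.mono_neutral_left) (auto simp: coeff_eq_0)
  also have "b ^ d * \<dots> = hom_eval d p a b"
    unfolding hom_eval_def sum_distrib_left
    by (rule sum.cong) (use assms(2) in \<open>auto simp: power_diff power_divide field_simps\<close>)
  finally show ?thesis by simp
qed

lemma hom_eval_zero: "hom_eval d p a 0 = coeff p d * a ^ d"
proof -
  have "hom_eval d p a 0 = (\<Sum>i\<le>d. if i = d then coeff p d * a ^ d else 0)"
    unfolding hom_eval_def by (rule sum.cong) (auto simp: zero_power)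
  then show ?thesis by simp
qed

lemma degree_rat_num_le: "degree (rat_num f) \<le> rat_degree f"
  and degree_rat_den_le: "degree (rat_den f) \<le> rat_degree f"
  by (simp_all add: rat_degree_def)

lemma rat_degree_coeff:
  "coeff (rat_num f) (rat_degree f) \<noteq> 0 \<or> coeff (rat_den f) (rat_degree f) \<noteq> 0"
proof (cases "degree (rat_num f) > degree (rat_den f)")
  case True
  then have "rat_num f \<noteq> 0" by auto
  then show ?thesis using True by (simp add: rat_degree_def)
next
  case False
  then show ?thesis by (simp add: rat_degree_def rat_den_nonzero)
qed

lemma rat_map_cp1_point:
  assumes "a \<noteq> 0 \<or> b \<noteq> 0"
  shows "rat_map f (cp1_point a b)
      = cp1_point (hom_eval (rat_degree f) (rat_num f) a b) (hom_eval (rat_degree f) (rat_den f) a b)"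
proof (cases "b = 0")
  case True
  then show ?thesis
    using assms cp1_point_scale[of "a ^ rat_degree f"]
    by (simp add: hom_eval_zero rat_map_Infty_cp1_point cp1_point_def del: rat_map.simps)
next
  case False
  then show ?thesis
    using cp1_point_scale[of "b ^ rat_degree f"]
    by (simp add: hom_eval_nonzero degree_rat_num_le degree_rat_den_le rat_map_Finite_cp1_point cp1_point_def
        del: rat_map.simps)
qed

text \<open>
  The homogenised numerator and denominator have no common zero on the projective line; at
  infinity this holds because one of them has degree exactly \<open>rat_degree f\<close>.
\<close>

lemma hom_eval_rat_nonzero:
  assumes "a \<noteq> 0 \<or> b \<noteq> 0"
  shows "hom_eval (rat_degree f) (rat_num f) a b \<noteq> 0 \<or> hom_eval (rat_degree f) (rat_den f) a b \<noteq> 0"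
proof (cases "b = 0")
  case True
  then show ?thesis using assms rat_degree_coeff[of f] by (simp add: hom_eval_zero)
next
  case False
  then show ?thesis using no_common_zero_rat_num_den[of f "a / b"]
    by (simp add: hom_eval_nonzero degree_rat_num_le degree_rat_den_le)
qed

text \<open>
  The coefficient in the top admissible degree is multiplicative even if the degree bounds are not
  attained. It is the value at infinity of a homogeneous form.
\<close>

lemma coeff_mult_degree_bound:
  assumes "degree p \<le> m" "degree q \<le> l"
  shows "coeff (p * q) (m + l) = coeff p m * coeff q l"
proof (cases "degree p = m \<and> degree q = l")
  case True
  then show ?thesis using coeff_mult_degree_sum[of p q] by simp
next
  case False
  then have "degree (p * q) < m + l"
    using assms degree_mult_le[of p q] by linarith
  moreover have "coeff p m * coeff q l = 0"
    using False assms by (metis coeff_eq_0 le_neq_implies_less mult_zero_left mult_zero_right)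
  ultimately show ?thesis by (simp add: coeff_eq_0)
qed

lemma coeff_power_degree_bound:
  assumes "degree p \<le> m"
  shows "coeff (p ^ i) (m * i) = coeff p m ^ i"
proof (induction i)
  case (Suc i)
  have "degree (p ^ i) \<le> m * i"
    using degree_power_le[of p i] assms by (meson le_trans mult_le_mono1)
  from coeff_mult_degree_bound[OF assms this] Suc show ?case by simp
qed simp

definition hom_poly :: "nat \<Rightarrow> complex poly \<Rightarrow> complex poly \<Rightarrow> complex poly \<Rightarrow> complex poly" where
  "hom_poly d p A B = (\<Sum>i\<le>d. smult (coeff p i) (A ^ i * B ^ (d - i)))"

lemma poly_hom_poly: "poly (hom_poly d p A B) z = hom_eval d p (poly A z) (poly B z)"
  by (simp add: hom_poly_def hom_eval_def poly_sum mult.assoc)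

lemma hom_poly_bounds:
  assumes "degree A \<le> e" "degree B \<le> e"
  shows "degree (hom_poly d p A B) \<le> e * d"
    and "coeff (hom_poly d p A B) (e * d) = hom_eval d p (coeff A e) (coeff B e)"
proof -
  have deg: "degree (A ^ i) \<le> e * i" "degree (B ^ i) \<le> e * i" for i
    using degree_power_le[of A i] degree_power_le[of B i] assms by (meson le_trans mult_le_mono1)+
  have split: "e * i + e * (d - i) = e * d" if "i \<le> d" for i
    using that by (simp flip: distrib_left)
  have "degree (A ^ i * B ^ (d - i)) \<le> e * d" if "i \<le> d" for i
    using degree_mult_le[of "A ^ i" "B ^ (d - i)"] deg(1)[of i] deg(2)[of "d - i"] split[OF that]
    by linarith
  then show "degree (hom_poly d p A B) \<le> e * d"
    unfolding hom_poly_def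
    by (intro degree_sum_le) (auto intro: order_trans[OF degree_smult_le])
  have "coeff (A ^ i * B ^ (d - i)) (e * d) = coeff A e ^ i * coeff B e ^ (d - i)" if "i \<le> d" for i
    using coeff_mult_degree_bound[OF deg(1)[of i] deg(2)[of "d - i"]] split[OF that]
      coeff_power_degree_bound[OF assms(1), of i] coeff_power_degree_bound[OF assms(2), of "d - i"]
    by simp
  then show "coeff (hom_poly d p A B) (e * d) = hom_eval d p (coeff A e) (coeff B e)"
    by (simp add: hom_poly_def hom_eval_def coeff_sum mult.assoc)
qed

text \<open>
  Substituting the homogeneous coordinates of \<open>g\<close> into those of \<open>f\<close> gives a pair without common zeros,
  so it is in lowest terms and describes the composition at every point. The
  hypothesis excludes the constant infinity, which is not an element of the fraction field.
\<close>

lemma ex_rat_map_comp: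
  assumes "rat_map f (rat_map g (Finite z0)) \<noteq> Infty"
  shows "\<exists>h. rat_map h = rat_map f \<circ> rat_map g"
proof -
  define d e where "d = rat_degree f" and "e = rat_degree g"
  define N D where "N = hom_poly d (rat_num f) (rat_num g) (rat_den g)"
    and "D = hom_poly d (rat_den f) (rat_num g) (rat_den g)"
  have fin: "rat_map f (rat_map g (Finite z)) = cp1_point (poly N z) (poly D z)" for z
    unfolding N_def D_def poly_hom_poly d_def rat_map_Finite_cp1_point[of g]
    by (rule rat_map_cp1_point[OF no_common_zero_rat_num_den])
  have inf: "rat_map f (rat_map g Infty) = cp1_point (coeff N (e * d)) (coeff D (e * d))"
    unfolding N_def D_def rat_map_Infty_cp1_point[of g] d_def
    by (subst (1 2) hom_poly_bounds(2))
      (simp_all add: e_def degree_rat_num_le degree_rat_den_le rat_map_cp1_point[OF rat_degree_coeff])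
  have "D \<noteq> 0" using assms fin[of z0] by (auto simp: cp1_point_def)
  moreover have "coprime N D"
    unfolding N_def D_def d_def
    by (rule coprime_if_no_common_zero, unfold poly_hom_poly,
        rule hom_eval_rat_nonzero[OF no_common_zero_rat_num_den])
  moreover have "coeff N (e * d) \<noteq> 0 \<or> coeff D (e * d) \<noteq> 0"
    unfolding N_def D_def using hom_eval_rat_nonzero[OF rat_degree_coeff, of f g]
    by (subst (1 2) hom_poly_bounds(2))
      (simp_all add: e_def d_def degree_rat_num_le degree_rat_den_le)
  moreover have "degree N \<le> e * d" "degree D \<le> e * d"
    unfolding N_def D_def
    by (rule hom_poly_bounds(1), simp_all add: e_def degree_rat_num_le degree_rat_den_le)+
  ultimately have "rat_map (Fraction_Field.Fract N D) w = rat_map f (rat_map g w)" for w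
    using rat_map_Fract_Finite[of N D] rat_map_Fract_Infty[of N D "e * d"] fin inf
    by (cases w) (simp_all del: rat_map.simps)
  then show ?thesis by (intro exI[of _ "Fraction_Field.Fract N D"]) (simp add: fun_eq_iff del: rat_map.simps)
qed


section \<open>Generic points and the field of rational functions\<close>

lemma ex_generic:
  assumes "\<forall>\<^sub>F z :: complex in cofinite. P z"
  obtains z where "P z"
  using eventually_happens'[OF _ assms] infinite_UNIV_char_0[where 'a = complex] by auto

lemma generic_poly_nonzero:
  fixes p :: "complex poly"
  assumes "p \<noteq> 0"
  shows "\<forall>\<^sub>F z in cofinite. poly p z \<noteq> 0"
  using poly_roots_finite[OF assms] by (simp add: eventually_cofinite)

lemma poly_eqI_generic:
  fixes p q :: "complex poly"
  assumes "\<forall>\<^sub>F z in cofinite. poly p z = poly q z"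
  shows "p = q"
proof (rule ccontr)
  assume "p \<noteq> q"
  then have "\<forall>\<^sub>F z in cofinite. poly (p - q) z \<noteq> 0"
    by (intro generic_poly_nonzero) simp
  with assms have "\<forall>\<^sub>F z :: complex in cofinite. False"
    by eventually_elim simp
  then show False by (rule ex_generic)
qed

lemma generic_neq: "\<forall>\<^sub>F z :: complex in cofinite. z \<noteq> c"
  by (simp add: eventually_cofinite)

text \<open>
  The maps along which identities at generic points can be substituted. For rational functions
  this means being nonconstant.
\<close>

definition finite_fibres :: "(complex \<Rightarrow> complex) \<Rightarrow> bool" where
  "finite_fibres k \<longleftrightarrow> (\<forall>c. \<forall>\<^sub>F z in cofinite. k z \<noteq> c)"

lemma finite_fibresD: "finite_fibres k \<Longrightarrow> \<forall>\<^sub>F z in cofinite. k z \<noteq> c"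
  by (simp add: finite_fibres_def)

lemma generic_compose:
  assumes "finite_fibres k" "\<forall>\<^sub>F z in cofinite. P z"
  shows "\<forall>\<^sub>F z in cofinite. P (k z)"
proof -
  have "finite {c. \<not> P c}" using assms(2) by (simp add: eventually_cofinite)
  then have "\<forall>\<^sub>F z in cofinite. \<forall>c\<in>{c. \<not> P c}. k z \<noteq> c"
    using assms(1) by (intro eventually_ball_finite) (auto simp: finite_fibres_def)
  then show ?thesis by eventually_elim auto
qed

lemma finite_fibres_comp: "finite_fibres h \<Longrightarrow> finite_fibres k \<Longrightarrow> finite_fibres (\<lambda>z. h (k z))"
  unfolding finite_fibres_def[of "\<lambda>z. h (k z)"]
  using generic_compose[of k "\<lambda>w. h w \<noteq> _"] finite_fibresD by blast

lemma finite_fibres_inj: "inj k \<Longrightarrow> finite_fibres k"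
  unfolding finite_fibres_def eventually_cofinite
  using finite_vimageI[of "{_}" k] by (auto simp: vimage_def)

lemma finite_fibres_power: "n > 0 \<Longrightarrow> finite_fibres (\<lambda>z. z ^ n)"
  by (auto simp: finite_fibres_def eventually_cofinite)

lemma finite_fibres_inverse: "finite_fibres (\<lambda>z. 1 / z)"
  by (rule finite_fibres_inj) (simp add: inj_def)

lemma finite_fibres_scale: "c \<noteq> 0 \<Longrightarrow> finite_fibres (\<lambda>z. c * z)"
  by (rule finite_fibres_inj) (simp add: inj_def)

lemma rat_den_generic: "\<forall>\<^sub>F z in cofinite. poly (rat_den f) z \<noteq> 0"
  by (rule generic_poly_nonzero[OF rat_den_nonzero])

text \<open>
  Working with \<^const>\<open>rat_eval\<close>, whose junk values occur at finitely many points only, makes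
  generic identities amenable to ordinary algebra.
\<close>

lemma represents_iff_eval: "represents f h \<longleftrightarrow> (\<forall>\<^sub>F z in cofinite. rat_eval f z = h z)"
proof
  assume "represents f h"
  then show "\<forall>\<^sub>F z in cofinite. rat_eval f z = h z"
    unfolding represents_def by (rule eventually_mono) (simp split: if_splits)
next
  assume "\<forall>\<^sub>F z in cofinite. rat_eval f z = h z"
  with rat_den_generic[of f] show "represents f h"
    unfolding represents_def by eventually_elim simp
qed

lemma represents_eval: "represents f (rat_eval f)"
  by (simp add: represents_iff_eval)

lemma represents_cong:
  assumes "represents f h" "\<forall>\<^sub>F z in cofinite. h z = h' z"
  shows "represents f h'"
  using assms unfolding represents_iff_eval by eventually_elim simp

lemma represents_generic_eq:
  assumes "represents f h" "represents f h'"
  shows "\<forall>\<^sub>F z in cofinite. h z = h' z"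
  using assms unfolding represents_iff_eval by eventually_elim simp

lemma represents_Fract:
  assumes "q \<noteq> 0"
  shows "represents (Fraction_Field.Fract p q) (\<lambda>z. poly p z / poly q z)"
proof -
  let ?f = "Fraction_Field.Fract p q"
  have "Fraction_Field.Fract (rat_num ?f) (rat_den ?f) = ?f" by (rule Fract_rat_num_den)
  then have "rat_num ?f * q = p * rat_den ?f"
    using assms by (simp add: eq_fract rat_den_nonzero)
  then have eq: "poly (rat_num ?f) z * poly q z = poly p z * poly (rat_den ?f) z" for z
    by (metis poly_mult)
  show ?thesis
    unfolding represents_iff_eval using rat_den_generic[of ?f] generic_poly_nonzero[OF assms]
    by eventually_elim (simp add: rat_eval_def frac_eq_eq eq)
qed

lemma represents_const: "represents (Fraction_Field.Fract [:c:] 1) (\<lambda>z. c)"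
  using represents_Fract[of 1 "[:c:]"] by simp

lemma represents_1: "represents 1 (\<lambda>z. 1)"
  using represents_const[of 1] by (simp add: One_fract_def one_pCons)

lemma represents_0: "represents 0 (\<lambda>z. 0)"
  using represents_const[of 0] by (simp add: Zero_fract_def)

lemma represents_ratX: "represents ratX (\<lambda>z. z)"
  using represents_Fract[of 1 "[:0, 1:]"] by simp

lemma represents_add:
  assumes "represents f h" "represents g k"
  shows "represents (f + g) (\<lambda>z. h z + k z)"
proof -
  let ?p = "rat_num f" and ?q = "rat_den f" and ?p' = "rat_num g" and ?q' = "rat_den g"
  have "f + g = Fraction_Field.Fract (?p * ?q' + ?p' * ?q) (?q * ?q')"
    using Fract_rat_num_den[of f] Fract_rat_num_den[of g] add_fract[OF rat_den_nonzero rat_den_nonzero]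
    by metis
  then have "represents (f + g) (\<lambda>z. poly (?p * ?q' + ?p' * ?q) z / poly (?q * ?q') z)"
    using represents_Fract[of "?q * ?q'"] by (simp add: rat_den_nonzero del: poly_mult poly_add)
  moreover have "\<forall>\<^sub>F z in cofinite. poly (?p * ?q' + ?p' * ?q) z / poly (?q * ?q') z = h z + k z"
    using assms[unfolded represents_iff_eval] rat_den_generic[of f] rat_den_generic[of g]
    by eventually_elim (auto simp: rat_eval_def field_simps)
  ultimately show ?thesis by (rule represents_cong)
qed

lemma represents_mult:
  assumes "represents f h" "represents g k"
  shows "represents (f * g) (\<lambda>z. h z * k z)"
proof -
  let ?p = "rat_num f" and ?q = "rat_den f" and ?p' = "rat_num g" and ?q' = "rat_den g"
  have "f * g = Fraction_Field.Fract (?p * ?p') (?q * ?q')"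
    using Fract_rat_num_den[of f] Fract_rat_num_den[of g] mult_fract
    by metis
  then have "represents (f * g) (\<lambda>z. poly (?p * ?p') z / poly (?q * ?q') z)"
    using represents_Fract[of "?q * ?q'"] by (simp add: rat_den_nonzero del: poly_mult poly_add)
  moreover have "\<forall>\<^sub>F z in cofinite. poly (?p * ?p') z / poly (?q * ?q') z = h z * k z"
    using assms[unfolded represents_iff_eval] rat_den_generic[of f] rat_den_generic[of g]
    by eventually_elim (auto simp: rat_eval_def field_simps)
  ultimately show ?thesis by (rule represents_cong)
qed

lemma represents_diff:
  assumes "represents f h" "represents g k"
  shows "represents (f - g) (\<lambda>z. h z - k z)"
proof -
  have "Fraction_Field.Fract [:-1:] 1 = (- 1 :: ratfun)"
    by (simp add: One_fract_def one_pCons)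
  then show ?thesis
    using represents_add[OF assms(1) represents_mult[OF represents_const[of "-1"] assms(2)]] by simp
qed

text \<open>
  This covers \<open>f = 0\<close> as well, since inversion maps \<open>0\<close> to \<open>0\<close> in both fields.
\<close>

lemma represents_inverse:
  assumes "represents f h"
  shows "represents (inverse f) (\<lambda>z. inverse (h z))"
proof (cases "f = 0")
  case True
  then have "\<forall>\<^sub>F z in cofinite. 0 = h z"
    using assms represents_generic_eq[OF represents_0, of h] by simp
  then have "\<forall>\<^sub>F z in cofinite. 0 = inverse (h z)" by eventually_elim simp
  then show ?thesis using True represents_cong[OF represents_0] by simp
next
  case False
  let ?p = "rat_num f" and ?q = "rat_den f"
  have "?p \<noteq> 0"
    using False Fract_rat_num_den[of f] by (metis fract_collapse(1))
  moreover have "inverse f = Fraction_Field.Fract ?q ?p"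
    using Fract_rat_num_den[of f] inverse_fract by metis
  ultimately have "represents (inverse f) (\<lambda>z. poly ?q z / poly ?p z)"
    using represents_Fract[of ?p] by simp
  moreover have "\<forall>\<^sub>F z in cofinite. poly ?q z / poly ?p z = inverse (h z)"
    using assms[unfolded represents_iff_eval]
    by eventually_elim (metis inverse_divide rat_eval_def)
  ultimately show ?thesis by (rule represents_cong)
qed

lemma represents_divide:
  assumes "represents f h" "represents g k"
  shows "represents (f / g) (\<lambda>z. h z / k z)"
  using represents_mult[OF assms(1) represents_inverse[OF assms(2)]]
  by (simp add: divide_inverse)

lemma represents_power:
  assumes "represents f h"
  shows "represents (f ^ i) (\<lambda>z. h z ^ i)"
  by (induction i) (simp_all add: represents_1 represents_mult[OF assms])

lemma represents_nonzero:
  assumes "represents f h" "f \<noteq> 0"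
  shows "\<forall>\<^sub>F z in cofinite. h z \<noteq> 0"
proof -
  have "represents (f * inverse f) (\<lambda>z. h z * inverse (h z))"
    by (intro represents_mult represents_inverse assms)
  then have "\<forall>\<^sub>F z in cofinite. h z * inverse (h z) = 1"
    using represents_generic_eq[OF _ represents_1] assms(2) by simp
  then show ?thesis by eventually_elim auto
qed

lemma constant_generic:
  assumes "represents f h" "\<not> nonconstant f"
  shows "\<exists>c. \<forall>\<^sub>F z in cofinite. h z = c"
proof -
  have "degree (rat_num f) = 0" "degree (rat_den f) = 0"
    using assms(2) by (simp_all add: nonconstant_def rat_degree_def)
  then obtain a b where "rat_num f = [:a:]" "rat_den f = [:b:]"
    by (metis degree_eq_zeroE)
  then have const: "rat_eval f z = a / b" for z by (simp add: rat_eval_def)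
  have "\<forall>\<^sub>F z in cofinite. h z = a / b"
    using assms(1)[unfolded represents_iff_eval] by eventually_elim (simp add: const)
  then show ?thesis by blast
qed

lemma nonconstant_iff_finite_fibres:
  assumes "represents f h"
  shows "nonconstant f \<longleftrightarrow> finite_fibres h"
proof
  assume nc: "nonconstant f"
  show "finite_fibres h"
    unfolding finite_fibres_def
  proof
    fix c
    have "rat_num f - smult c (rat_den f) \<noteq> 0"
    proof
      assume "rat_num f - smult c (rat_den f) = 0"
      then have *: "rat_num f = smult c (rat_den f)" by simp
      then have "rat_den f dvd rat_num f" by (simp add: dvd_smult)
      then have "is_unit (rat_den f)"
        using coprime_rat_num_den[of f] by (meson coprime_common_divisor dvd_refl)
      then have "degree (rat_den f) = 0" by (simp add: is_unit_iff_degree rat_den_nonzero)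
      then show False
        using nc * degree_smult_le[of c "rat_den f"] by (simp add: nonconstant_def rat_degree_def)
    qed
    then have "\<forall>\<^sub>F z in cofinite. poly (rat_num f - smult c (rat_den f)) z \<noteq> 0"
      by (rule generic_poly_nonzero)
    with rat_den_generic[of f] assms[unfolded represents_iff_eval]
    show "\<forall>\<^sub>F z in cofinite. h z \<noteq> c"
      by eventually_elim (auto simp: rat_eval_def field_simps)
  qed
next
  assume ff: "finite_fibres h"
  show "nonconstant f"
  proof (rule ccontr)
    assume "\<not> nonconstant f"
    then obtain c where "\<forall>\<^sub>F z in cofinite. h z = c"
      using constant_generic[OF assms] by blast
    with finite_fibresD[OF ff, of c] have "\<forall>\<^sub>F z :: complex in cofinite. False"
      by eventually_elim simp
    then show False by (rule ex_generic)
  qed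
qed

text \<open>
  As \<open>k\<close> has finite fibres, the value of \<open>g\<close> at a generic point is not a pole of \<open>f\<close>. So the composition is not
  the constant infinity, and it is represented by composing the expressions.
\<close>

lemma represents_composition:
  assumes "represents f h" "represents g k" "finite_fibres k"
  obtains F where "rat_map F = rat_map f \<circ> rat_map g" "represents F (\<lambda>z. h (k z))"
proof -
  have "\<forall>\<^sub>F z in cofinite. rat_map f (Finite (k z)) = Finite (h (k z))"
    by (rule generic_compose[OF assms(3) assms(1)[unfolded represents_def]])
  with assms(2)[unfolded represents_def]
  have *: "\<forall>\<^sub>F z in cofinite. rat_map f (rat_map g (Finite z)) = Finite (h (k z))"
    by eventually_elim (simp del: rat_map.simps)
  obtain z where "rat_map f (rat_map g (Finite z)) = Finite (h (k z))"
    by (rule ex_generic[OF *])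
  then have "rat_map f (rat_map g (Finite z)) \<noteq> Infty" by (simp del: rat_map.simps)
  from ex_rat_map_comp[OF this] obtain F where F: "rat_map F = rat_map f \<circ> rat_map g" by blast
  moreover have "represents F (\<lambda>z. h (k z))"
    using * unfolding represents_def F comp_def .
  ultimately show ?thesis by (rule that)
qed

lemma ex_represents_comp:
  assumes "represents f h" "represents g k" "finite_fibres k"
  shows "\<exists>F. represents F (\<lambda>z. h (k z))"
  using represents_composition[OF assms] by metis

lemma rat_map_comp_eq:
  assumes "represents f h" "represents g k" "finite_fibres k" "represents F (\<lambda>z. h (k z))"
  shows "rat_map F = rat_map f \<circ> rat_map g"
  using represents_composition[OF assms(1-3)] represents_unique[OF assms(4)] by metis

lemma finite_fibres_imp_nonzero:
  assumes "represents f h" "finite_fibres h"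
  shows "f \<noteq> 0"
proof
  assume "f = 0"
  then have "\<forall>\<^sub>F z in cofinite. h z = 0"
    using assms(1) represents_generic_eq[OF _ represents_0] by simp
  with finite_fibresD[OF assms(2), of 0] have "\<forall>\<^sub>F z :: complex in cofinite. False"
    by eventually_elim simp
  then show False by (rule ex_generic)
qed

text \<open>
  Substituting rational functions into a polynomial in two variables gives a rational function.
  It lets a product of such substitutions vanish only if a factor does.
\<close>

lemma represents_bivariate:
  assumes "represents u h" "represents v k"
  shows "\<exists>g. represents g (\<lambda>t. poly (poly a [:k t:]) (h t))"
proof -
  have univ: "\<exists>g. represents g (\<lambda>t. poly p (h t))" for p
  proof (induction p)
    case 0
    then show ?case using represents_0 by auto
  next
    case (pCons c p)
    then obtain g where "represents g (\<lambda>t. poly p (h t))" by blast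
    then have "represents (Fraction_Field.Fract [:c:] 1 + u * g) (\<lambda>t. c + h t * poly p (h t))"
      by (intro represents_add represents_mult represents_const assms)
    then show ?case by auto
  qed
  show ?thesis
  proof (induction a)
    case 0
    then show ?case using represents_0 by auto
  next
    case (pCons p a)
    then obtain g where "represents g (\<lambda>t. poly (poly a [:k t:]) (h t))" by blast
    moreover obtain g' where "represents g' (\<lambda>t. poly p (h t))" using univ by blast
    ultimately have "represents (g' + v * g) (\<lambda>t. poly p (h t) + k t * poly (poly a [:k t:]) (h t))"
      by (intro represents_add represents_mult assms)
    then show ?case by auto
  qed
qed

text \<open>
  At a point where the Wronskian of numerator and denominator does not vanish, the point is a simple
  root of its fibre polynomial. That polynomial has degree at least \<open>2\<close>, unless the point is mapped to
  the image of infinity, so there is another root.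
\<close>

lemma generic_second_preimage:
  assumes "rat_degree w \<ge> 2"
  shows "\<forall>\<^sub>F z in cofinite. \<exists>z'. z' \<noteq> z \<and> rat_map w (Finite z') = rat_map w (Finite z)"
proof -
  define p q where "p = rat_num w" and "q = rat_den w"
  have cop: "coprime p q" unfolding p_def q_def by (rule coprime_rat_num_den)
  have q0: "q \<noteq> 0" by (simp add: q_def rat_den_nonzero)
  have d: "max (degree p) (degree q) \<ge> 2" using assms by (simp add: rat_degree_def p_def q_def)
  \<comment> \<open>It is not zero: otherwise \<open>p\<close> and \<open>q\<close> would divide their own derivatives and be constant.\<close>
  define W where "W = pderiv p * q - p * pderiv q"
  have "W \<noteq> 0"
  proof
    assume "W = 0"
    then have eq: "pderiv p * q = p * pderiv q" by (simp add: W_def)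
    have "q dvd pderiv q"
      using cop eq by (metis coprime_commute coprime_dvd_mult_right_iff dvd_triv_right)
    moreover have "p dvd pderiv p"
      using cop eq by (metis coprime_dvd_mult_left_iff dvd_triv_left)
    ultimately have "degree q = 0" "degree p = 0"
      using dvd_imp_degree_le[of q "pderiv q"] dvd_imp_degree_le[of p "pderiv p"]
      by (auto simp: degree_pderiv pderiv_eq_0_iff)
    then show False using d by simp
  qed
  have nc: "nonconstant w" using assms by (simp add: nonconstant_def)
  define d where "d = rat_degree w"
  have deg_gen: "\<forall>\<^sub>F z in cofinite. degree (p - smult (poly p z / poly q z) q) \<ge> 2"
  proof -
    have "\<forall>\<^sub>F z in cofinite. rat_eval w z \<noteq> coeff p d / coeff q d"
      using nc nonconstant_iff_finite_fibres[OF represents_eval, of w] finite_fibresD by blast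
    then show ?thesis
    proof eventually_elim
      case (elim z)
      have "coeff p d - poly p z / poly q z * coeff q d \<noteq> 0"
      proof (cases "coeff q d = 0")
        case True
        then show ?thesis using rat_degree_coeff[of w] by (simp add: d_def p_def q_def)
      next
        case False
        have "poly p z / poly q z \<noteq> coeff p d / coeff q d"
          using elim by (simp add: rat_eval_def p_def q_def)
        then show ?thesis using False by (metis nonzero_eq_divide_eq right_minus_eq)
      qed
      then have "coeff (p - smult (poly p z / poly q z) q) d \<noteq> 0" by simp
      then have "d \<le> degree (p - smult (poly p z / poly q z) q)" by (rule le_degree)
      then show ?case using assms by (simp add: d_def)
    qed
  qed
  show ?thesis
    using deg_gen generic_poly_nonzero[OF q0] generic_poly_nonzero[OF \<open>W \<noteq> 0\<close>]
  proof eventually_elim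
    case (elim z)
    define c where "c = poly p z / poly q z"
    define h where "h = p - smult c q"
    have "poly h z = 0" using elim(2) by (simp add: h_def c_def)
    then obtain g where g: "h = [:- z, 1:] * g" by (metis dvdE poly_eq_0_iff_dvd)
    have "h \<noteq> 0" using elim(1) by (auto simp: h_def c_def)
    then have "g \<noteq> 0" using g by auto
    have "degree h = degree [:- z, 1:] + degree g"
      unfolding g by (rule degree_mult_eq) (use \<open>g \<noteq> 0\<close> in auto)
    then have "degree g \<noteq> 0" using elim(1) by (simp add: h_def c_def)
    then obtain z' where z': "poly g z' = 0" using alg_closed_imp_poly_has_root[of g] by auto
    have "z' \<noteq> z"
    proof
      assume "z' = z"
      have "poly (pderiv h) z = poly g z"
        unfolding g pderiv_mult by (simp add: pderiv_pCons)
      then have "poly (pderiv p) z - c * poly (pderiv q) z = 0"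
        using z' \<open>z' = z\<close> by (simp add: h_def pderiv_diff pderiv_smult)
      moreover have "poly p z = c * poly q z" using elim(2) by (simp add: c_def)
      then have "poly W z = poly q z * (poly (pderiv p) z - c * poly (pderiv q) z)"
        by (simp add: W_def algebra_simps)
      ultimately have "poly W z = 0" by simp
      then show False using elim(3) by simp
    qed
    moreover have "poly p z' = c * poly q z'"
      using arg_cong[OF g, of "\<lambda>p. poly p z'"] z' by (simp add: h_def)
    moreover from this have "poly q z' \<noteq> 0"
      using coprime_poly_0[OF cop, of z'] by auto
    ultimately show ?case
      using elim(2) by (intro exI[of _ z']) (simp add: rat_eval_def p_def[symmetric] q_def[symmetric] c_def)
  qed
qed


section \<open>Roots of unity and rotations\<close>

lemma primitive_root_of_unity:
  assumes "n > 0"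
  obtains \<zeta> :: complex where "\<zeta> ^ n = 1" "\<And>i. \<zeta> ^ i = 1 \<Longrightarrow> n dvd i"
    "\<And>c. c ^ n = 1 \<Longrightarrow> \<exists>k. c = \<zeta> ^ k"
proof -
  define \<zeta> where "\<zeta> = cis (2 * pi / real n)"
  have pow: "\<zeta> ^ k = cis (2 * pi * real k / real n)" for k
    unfolding \<zeta>_def Complex.DeMoivre by (rule arg_cong[of _ _ cis]) simp
  have bij: "bij_betw (\<lambda>k. \<zeta> ^ k) {..<n} {z. z ^ n = 1}"
    unfolding pow by (rule Complex.bij_betw_roots_unity[OF assms])
  have root: "\<zeta> ^ n = 1" unfolding pow using assms by simp
  have "n dvd i" if "\<zeta> ^ i = 1" for i
  proof -
    have "\<zeta> ^ i = (\<zeta> ^ n) ^ (i div n) * \<zeta> ^ (i mod n)"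
      by (simp flip: power_mult power_add)
    then have "\<zeta> ^ (i mod n) = \<zeta> ^ 0" using that root by simp
    then have "i mod n = 0"
      using bij assms unfolding bij_betw_def inj_on_def by (metis lessThan_iff mod_less_divisor)
    then show ?thesis by (simp add: mod_eq_0_iff_dvd)
  qed
  moreover have "\<exists>k. c = \<zeta> ^ k" if "c ^ n = 1" for c
    using bij that unfolding bij_betw_def by (metis (mono_tags, lifting) imageE mem_Collect_eq)
  ultimately show ?thesis using root that by blast
qed

lemma multiplicative_order:
  fixes \<omega> :: complex
  assumes "\<omega> ^ n = 1" "n > 0"
  obtains m where "m > 0" "\<omega> ^ m = 1" "\<And>i. \<omega> ^ i = 1 \<Longrightarrow> m dvd i"
proof -
  define m where "m = (LEAST m. m > 0 \<and> \<omega> ^ m = 1)"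
  have m: "m > 0" "\<omega> ^ m = 1"
    using LeastI[of "\<lambda>m. m > 0 \<and> \<omega> ^ m = 1" n] assms by (simp_all add: m_def)
  have "m dvd i" if "\<omega> ^ i = 1" for i
  proof (rule ccontr)
    assume "\<not> m dvd i"
    then have "i mod m > 0" using mod_eq_0_iff_dvd by (metis gr0I)
    moreover have "\<omega> ^ i = (\<omega> ^ m) ^ (i div m) * \<omega> ^ (i mod m)"
      by (simp flip: power_mult power_add)
    then have "\<omega> ^ (i mod m) = 1" using that m(2) by simp
    ultimately have "m \<le> i mod m" unfolding m_def by (intro Least_le) simp
    then show False using mod_less_divisor[OF m(1), of i] by simp
  qed
  with m show ?thesis by (rule that)
qed

text \<open>
  Raising to a power coprime to \<open>n\<close> is bijective on \<open>n\<close>-th roots of unity: a Bezout coefficient of \<open>r\<close>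
  gives the exponent of the inverse map.
\<close>

lemma root_of_unity_power_bij:
  fixes \<omega> :: complex
  assumes "gcd r (int n) = 1" "n > 0" "\<omega> ^ n = 1"
  shows "\<omega> powi r = 1 \<Longrightarrow> \<omega> = 1"
    and "\<exists>\<eta>. \<eta> ^ n = 1 \<and> \<eta> powi r = \<omega>"
proof -
  have "\<omega> \<noteq> 0" using assms(2,3) by (auto simp: power_0_left)
  obtain a b where "a * r + b * int n = 1"
    using bezout_int[of r "int n"] assms(1) by auto
  then have "\<omega> = \<omega> powi (r * a + int n * b)" by (simp add: mult.commute)
  also have "\<dots> = (\<omega> powi r) powi a * (\<omega> powi int n) powi b"
    using \<open>\<omega> \<noteq> 0\<close> by (metis power_int_add power_int_mult)
  also have "\<omega> powi int n = 1" using assms(3) by simp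
  finally have *: "\<omega> = (\<omega> powi r) powi a" by simp
  then show "\<omega> powi r = 1 \<Longrightarrow> \<omega> = 1" by simp
  have "(\<omega> powi a) ^ n = (\<omega> ^ n) powi a"
    by (metis mult.commute power_int_mult power_int_of_nat)
  then have "(\<omega> powi a) ^ n = 1" using assms(3) by simp
  moreover have "(\<omega> powi a) powi r = \<omega>" using * by (metis mult.commute power_int_mult)
  ultimately show "\<exists>\<eta>. \<eta> ^ n = 1 \<and> \<eta> powi r = \<omega>" by blast
qed

lemma Fract_power: "Fraction_Field.Fract p q ^ i = Fraction_Field.Fract (p ^ i) (q ^ i)"
  by (induction i) (simp_all add: One_fract_def)

lemma order_power:
  fixes p :: "complex poly"
  assumes "p \<noteq> 0"
  shows "order x (p ^ n) = n * order x p"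
  using assms by (induction n) (simp_all add: order_mult)

text \<open>
  In lowest terms \<open>f\<^sup>n = 1\<close> says that the \<open>n\<close>-th powers of the coprime numerator and denominator agree;
  so both are units.
\<close>

lemma ratfun_root_of_unity_constant:
  assumes "f ^ n = 1" "n > 0"
  obtains c where "c ^ n = 1" "represents f (\<lambda>z. c)"
proof -
  let ?p = "rat_num f" and ?q = "rat_den f"
  have "Fraction_Field.Fract (?p ^ n) (?q ^ n) = Fraction_Field.Fract 1 1"
    using assms(1) Fract_rat_num_den[of f] by (metis One_fract_def Fract_power)
  then have eq: "?p ^ n = ?q ^ n"
    by (simp add: eq_fract rat_den_nonzero)
  have "coprime (?p ^ n) (?q ^ n)"
    using coprime_rat_num_den[of f] by simp
  then have "is_unit (?p ^ n)" "is_unit (?q ^ n)" unfolding eq by (meson coprime_common_divisor dvd_refl)+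
  then have "is_unit ?p" "is_unit ?q"
    using assms(2) by (simp_all add: is_unit_power_iff)
  then obtain a b where ab: "?p = [:a:]" "?q = [:b:]"
    by (auto simp: is_unit_poly_iff)
  have "b \<noteq> 0" using rat_den_nonzero[of f] ab(2) by auto
  moreover have "a ^ n = b ^ n"
    using arg_cong[OF eq, of "\<lambda>p. poly p 0"] ab by simp
  ultimately have "(a / b) ^ n = 1" by (simp add: power_divide)
  moreover have "represents f (\<lambda>z. a / b)"
    using represents_eval[of f] ab by (simp add: rat_eval_def[abs_def])
  ultimately show ?thesis by (rule that)
qed

text \<open>
  The order of vanishing at \<open>0\<close> of an \<open>n\<close>-th power is a multiple of \<open>n\<close>.
\<close>

lemma ratX_power_eq_power_dvd:
  assumes "ratX ^ j = g ^ n"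
  shows "n dvd j"
proof -
  let ?p = "rat_num g" and ?q = "rat_den g"
  have "Fraction_Field.Fract ([:0, 1:] ^ j) 1 = Fraction_Field.Fract (?p ^ n) (?q ^ n)"
    using assms Fract_rat_num_den[of g] Fract_power[of "[:0, 1 :: complex:]" 1 j] Fract_power[of ?p ?q n] by simp
  then have eq: "[:0, 1:] ^ j * ?q ^ n = ?p ^ n"
    by (simp add: eq_fract rat_den_nonzero)
  moreover have "[:0, 1:] ^ j * ?q ^ n \<noteq> 0" by (simp add: rat_den_nonzero)
  ultimately have "order 0 ([:0, 1:] ^ j :: complex poly) + order 0 (?q ^ n) = order 0 (?p ^ n)"
    using order_mult[of "[:0, 1:] ^ j" "?q ^ n" 0] by simp
  moreover have "order 0 ([:0, 1:] ^ j :: complex poly) = j"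
    using order_power_n_n[of 0 j] by simp
  moreover have "?p \<noteq> 0 \<or> n = 0"
    using eq by (cases "n = 0") (auto simp: rat_den_nonzero power_0_left)
  ultimately have "j + n * order 0 ?q = n * order 0 ?p"
    by (auto simp: order_power rat_den_nonzero)
  then show ?thesis by (metis dvd_add_left_iff dvd_triv_left)
qed

text \<open>
  Since \<open>p/q\<close> is in lowest terms, invariance multiplies \<open>p\<close> and \<open>q\<close> by a common constant under the
  rotation. One of them has a nonzero constant term, so the constant is \<open>1\<close>, and then only
  exponents divisible by \<open>m\<close> occur in either.
\<close>

lemma rotation_invariant_imp_function_of_power:
  assumes root: "\<omega> ^ m = 1" "m > 0" "\<And>i. \<omega> ^ i = 1 \<Longrightarrow> m dvd i"
    and rep: "represents f h" and inv: "\<forall>\<^sub>F z in cofinite. h (\<omega> * z) = h z"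
  obtains H where "represents f (\<lambda>z. rat_eval H (z ^ m))"
proof -
  define p q where "p = rat_num f" and "q = rat_den f"
  define p' q' where "p' = pcompose p [:0, \<omega>:]" and "q' = pcompose q [:0, \<omega>:]"
  have [simp]: "\<omega> \<noteq> 0" using root(1,2) by (auto simp: power_0_left)
  have q0: "q \<noteq> 0" by (simp add: q_def rat_den_nonzero)
  have cop: "coprime p q" unfolding p_def q_def by (rule coprime_rat_num_den)
  have fh: "\<forall>\<^sub>F z in cofinite. poly p z / poly q z = h z"
    using rep by (simp add: represents_iff_eval rat_eval_def p_def q_def)
  have qn: "\<forall>\<^sub>F z in cofinite. poly q z \<noteq> 0" by (rule generic_poly_nonzero[OF q0])
  have "p' * q = p * q'"
  proof (rule poly_eqI_generic)
    note rot = generic_compose[OF finite_fibres_scale[OF \<open>\<omega> \<noteq> 0\<close>]]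
    show "\<forall>\<^sub>F z in cofinite. poly (p' * q) z = poly (p * q') z"
      using fh qn inv rot[OF fh] rot[OF qn]
    proof eventually_elim
      case (elim z)
      then have "poly p (\<omega> * z) / poly q (\<omega> * z) = poly p z / poly q z" by simp
      then show ?case using elim(2,5)
        by (simp add: p'_def q'_def poly_pcompose frac_eq_eq mult.commute)
    qed
  qed
  moreover have "q dvd q'"
    using cop calculation by (metis coprime_commute coprime_dvd_mult_right_iff dvd_triv_right)
  then obtain u where u: "q' = q * u" by (elim dvdE)
  have "q' \<noteq> 0"
  proof
    assume "q' = 0"
    moreover have "poly q z = poly q' (z / \<omega>)" for z
      by (simp add: q'_def poly_pcompose)
    ultimately have "poly q z = 0" for z by simp
    then show False using q0 poly_all_0_iff_0 by blast
  qed
  then have "u \<noteq> 0" using u by auto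
  then have "degree u = 0"
    using u q0 degree_mult_eq[of q u] degree_pcompose[of q "[:0, \<omega>:]"] by (simp add: q'_def)
  then obtain c where c: "u = [:c:]" by (metis degree_eq_zeroE)
  have q': "q' = smult c q" using u c by simp
  moreover have "p' * q = smult c p * q"
    using \<open>p' * q = p * q'\<close> q' by simp
  then have p': "p' = smult c p" using q0 mult_right_cancel by blast
  have coeff: "\<omega> ^ i * coeff p i = c * coeff p i" "\<omega> ^ i * coeff q i = c * coeff q i" for i
    using arg_cong[OF p', of "\<lambda>r. coeff r i"] arg_cong[OF q', of "\<lambda>r. coeff r i"]
    by (simp_all add: p'_def q'_def coeff_pcompose_linear)
  have "coeff p 0 \<noteq> 0 \<or> coeff q 0 \<noteq> 0"
    using coprime_poly_0[OF cop, of 0] by (auto simp: poly_0_coeff_0)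
  then have "c = 1" using coeff[of 0] by auto
  have expo: "m dvd i" if "coeff p i \<noteq> 0 \<or> coeff q i \<noteq> 0" for i
    using coeff[of i] \<open>c = 1\<close> that by (intro root(3)) auto
  \<comment> \<open>Dividing all exponents by \<open>m\<close>; nothing is lost, as only multiples of \<open>m\<close> occur.\<close>
  define collapse where "collapse r = (\<Sum>i\<le>degree r. monom (coeff r i) (i div m))" for r :: "complex poly"
  have collapse: "poly (collapse r) (z ^ m) = poly r z" if "\<And>i. coeff r i \<noteq> 0 \<Longrightarrow> m dvd i" for r z
  proof -
    have "poly (collapse r) (z ^ m) = (\<Sum>i\<le>degree r. coeff r i * (z ^ m) ^ (i div m))"
      by (simp add: collapse_def poly_sum poly_monom)
    also have "\<dots> = (\<Sum>i\<le>degree r. coeff r i * z ^ i)"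
    proof (rule sum.cong)
      fix i
      show "coeff r i * (z ^ m) ^ (i div m) = coeff r i * z ^ i"
        using that[of i] by (cases "coeff r i = 0") (auto simp flip: power_mult)
    qed simp
    finally show ?thesis by (simp add: poly_altdef)
  qed
  have cp: "poly (collapse p) (z ^ m) = poly p z" and cq: "poly (collapse q) (z ^ m) = poly q z" for z
    using expo by (auto intro!: collapse)
  have "collapse q \<noteq> 0"
  proof
    assume "collapse q = 0"
    then have "poly q z = 0" for z using cq[of z] by simp
    then show False using q0 poly_all_0_iff_0 by blast
  qed
  from represents_Fract[OF this, of "collapse p"]
  have "\<forall>\<^sub>F z in cofinite. rat_eval (Fraction_Field.Fract (collapse p) (collapse q)) (z ^ m)
      = poly (collapse p) (z ^ m) / poly (collapse q) (z ^ m)"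
    unfolding represents_iff_eval by (rule generic_compose[OF finite_fibres_power[OF root(2)]])
  then have "represents f (\<lambda>z. rat_eval (Fraction_Field.Fract (collapse p) (collapse q)) (z ^ m))"
    using fh rep unfolding represents_iff_eval by eventually_elim (simp add: cp cq)
  then show ?thesis by (rule that)
qed

lemma ratX_power_inverse: "ratX ^ k * inverse ratX ^ k = (1 :: ratfun)"
proof -
  have "ratX \<noteq> (0 :: ratfun)"
    by (simp add: Zero_fract_def eq_fract)
  then show ?thesis by (metis power_mult_distrib power_one right_inverse)
qed

lemma rat_degree_ratX_power: "rat_degree (ratX ^ m) = m"
proof -
  have X: "ratX ^ m = Fraction_Field.Fract ([:0, 1:] ^ m) 1"
    using Fract_power[of "[:0, 1 :: complex:]" 1 m] by simp
  obtain c where "c \<noteq> 0" "rat_num (ratX ^ m) = smult c ([:0, 1:] ^ m)"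
    "rat_den (ratX ^ m) = smult c 1"
    unfolding X by (rule rat_num_den_Fract[of "[:0, 1:] ^ m" 1]) simp_all
  then show ?thesis by (simp add: rat_degree_def degree_power_eq)
qed

text \<open>
  The map \<open>t \<mapsto> t\<^sup>n\<close> is onto, so exceptional points below come from exceptional points above.
\<close>

lemma generic_power_descend:
  assumes "\<forall>\<^sub>F t :: complex in cofinite. P (t ^ n)" "n > 0"
  shows "\<forall>\<^sub>F s in cofinite. P s"
proof -
  have "{s. \<not> P s} \<subseteq> (\<lambda>t. t ^ n) ` {t. \<not> P (t ^ n)}"
  proof
    fix s assume s: "s \<in> {s. \<not> P s}"
    obtain t where "s = t ^ n" using exists_complex_root[of n s] assms(2) by auto
    then show "s \<in> (\<lambda>t. t ^ n) ` {t. \<not> P (t ^ n)}" using s by auto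
  qed
  then show ?thesis
    using assms(1) unfolding eventually_cofinite by (meson finite_imageI finite_subset)
qed

lemma represents_rotation: "represents (Fraction_Field.Fract [:0, c:] 1) (\<lambda>z. c * z)"
  using represents_Fract[of 1 "[:0, c:]"] by (simp add: mult.commute)


section \<open>Functions commuting with the inversion\<close>

lemma inversion_eq_rat_map: "inversion = rat_map (inverse ratX)"
proof
  fix z
  have X: "inverse ratX = Fraction_Field.Fract 1 [:0, 1:]" by simp
  have cop: "coprime 1 [:0, 1 :: complex:]" by simp
  show "inversion z = rat_map (inverse ratX) z"
    unfolding X using rat_map_Fract_Finite[OF cop] rat_map_Fract_Infty[OF cop, of 1]
    by (cases z) (simp_all add: cp1_point_def del: rat_map.simps)
qed

text \<open>
  Commuting with the inversion is a functional equation at generic points. In the direction from right to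
  left both compositions are rational maps that agree generically, hence everywhere.
\<close>

lemma commuting_with_inversion_iff:
  assumes rep: "represents R h"
  shows "R \<in> commuting_with_inversion \<longleftrightarrow> (\<forall>\<^sub>F z in cofinite. h z * h (1 / z) = 1)"
proof
  assume "R \<in> commuting_with_inversion"
  then have comm: "rat_map R (inversion w) = inversion (rat_map R w)" for w
    unfolding commuting_with_inversion_def by (metis (mono_tags, lifting) comp_apply mem_Collect_eq)
  note gen = rep[unfolded represents_def]
  show "\<forall>\<^sub>F z in cofinite. h z * h (1 / z) = 1"
    using gen generic_compose[OF finite_fibres_inverse gen] generic_neq[of 0]
  proof eventually_elim
    case (elim z)
    then show ?case using comm[of "Finite z"] by (auto simp del: rat_map.simps split: if_splits)
  qed
next
  assume recip: "\<forall>\<^sub>F z in cofinite. h z * h (1 / z) = 1"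
  have repX: "represents (inverse ratX) (\<lambda>z. 1 / z)"
    using represents_inverse[OF represents_ratX] by (simp add: field_simps)
  obtain G where G: "rat_map G = rat_map R \<circ> inversion" "represents G (\<lambda>z. h (1 / z))"
    using represents_composition[OF rep repX finite_fibres_inverse] inversion_eq_rat_map by metis
  have *: "\<forall>\<^sub>F z in cofinite. inversion (rat_map R (Finite z)) = Finite (h (1 / z))"
    using recip rep[unfolded represents_def]
    by eventually_elim (auto simp del: rat_map.simps simp: field_simps)
  then obtain z where "inversion (rat_map R (Finite z)) = Finite (h (1 / z))"
    by (rule ex_generic)
  then obtain G' where G': "rat_map G' = inversion \<circ> rat_map R"
    using ex_rat_map_comp[of "inverse ratX" R z] unfolding inversion_eq_rat_map[symmetric] by auto
  have "represents G' (\<lambda>z. h (1 / z))"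
    using * unfolding represents_def G' comp_def .
  then have "G' = G" using G(2) by (rule represents_unique)
  then show "R \<in> commuting_with_inversion"
    using G(1) G' by (simp add: commuting_with_inversion_def)
qed


section \<open>The Joukowski map and its dihedral covers\<close>

text \<open>
  The quotient map of the sphere by the inversion \<open>s \<mapsto> 1/s\<close>.
\<close>

definition joukowski :: "complex \<Rightarrow> complex" where
  "joukowski s = (s + 1 / s) / 2"

lemma joukowski_inverse: "joukowski (1 / s) = joukowski s"
  by (simp add: joukowski_def add.commute)

lemma joukowski_quadratic: "s \<noteq> 0 \<Longrightarrow> 2 * s * joukowski s = s * s + 1"
  by (simp add: joukowski_def distrib_left)

text \<open>
  A polynomial form of the statement that \<open>J(s) = J(t)\<close> holds only for \<open>s = t\<close> and \<open>st = 1\<close>, suited to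
  being read as an identity between rational functions.
\<close>

lemma joukowski_diff:
  assumes "s \<noteq> 0" "t \<noteq> 0"
  shows "(s - t) * (s * t - 1) = 2 * s * t * (joukowski s - joukowski t)"
  using joukowski_quadratic[OF assms(1)] joukowski_quadratic[OF assms(2)] by algebra

lemma joukowski_eq_iff:
  assumes "s \<noteq> 0" "t \<noteq> 0"
  shows "joukowski s = joukowski t \<longleftrightarrow> s = t \<or> s = 1 / t"
proof -
  have "joukowski s = joukowski t \<longleftrightarrow> s - t = 0 \<or> s * t - 1 = 0"
    using assms joukowski_diff[OF assms] by (metis mult_eq_0_iff right_minus_eq zero_neq_numeral)
  then show ?thesis using assms by (auto simp: eq_divide_eq)
qed

lemma finite_fibres_joukowski: "finite_fibres joukowski"
  unfolding finite_fibres_def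
proof
  fix c :: complex
  have "\<forall>\<^sub>F s in cofinite. poly [:1, - 2 * c, 1:] s \<noteq> 0"
    by (rule generic_poly_nonzero) simp
  with generic_neq[of 0] show "\<forall>\<^sub>F s in cofinite. joukowski s \<noteq> c"
  proof eventually_elim
    case (elim s)
    have "poly [:1, - 2 * c, 1:] s = 2 * s * (joukowski s - c)"
      using joukowski_quadratic[OF elim(1)] by (simp add: algebra_simps)
    then show ?case using elim(2) by auto
  qed
qed

lemma represents_half_sum_power: "represents (half_sum_power n) (\<lambda>z. joukowski (z ^ n))"
  unfolding half_sum_power_def joukowski_def one_add_one[symmetric]
  by (intro represents_divide represents_add represents_power represents_ratX represents_1)

lemma finite_fibres_half_sum_power: "n > 0 \<Longrightarrow> finite_fibres (\<lambda>z. joukowski (z ^ n))"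
  by (rule finite_fibres_comp[OF finite_fibres_joukowski finite_fibres_power])

lemma joukowski_power:
  assumes "z \<noteq> 0"
  shows "2 * z ^ n * joukowski (z ^ n) = z ^ (2 * n) + 1"
proof -
  have "z ^ (2 * n) = z ^ n * z ^ n" by (simp only: mult_2 power_add)
  then show ?thesis using joukowski_quadratic[of "z ^ n"] assms by simp
qed

lemma half_sum_power_lowest_terms:
  assumes "n > 0"
  obtains c where "c \<noteq> 0" "rat_num (half_sum_power n) = smult c (monom 1 (2 * n) + 1)"
    "rat_den (half_sum_power n) = smult c (monom 2 n)"
proof -
  have q0: "monom 2 n \<noteq> (0 :: complex poly)" by simp
  have cop: "coprime (monom 1 (2 * n) + 1) (monom 2 n :: complex poly)"
    by (rule coprime_if_no_common_zero) (use assms in \<open>auto simp: poly_monom power_0_left\<close>)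
  have "represents (Fraction_Field.Fract (monom 1 (2 * n) + 1) (monom 2 n)) (\<lambda>z. joukowski (z ^ n))"
  proof (rule represents_cong[OF represents_Fract[OF q0]])
    show "\<forall>\<^sub>F z in cofinite. poly (monom 1 (2 * n) + 1) z / poly (monom 2 n) z = joukowski (z ^ n)"
      using generic_neq[of 0]
    proof eventually_elim
      case (elim z)
      then have "2 * z ^ n * joukowski (z ^ n) = poly (monom 1 (2 * n) + 1) z"
        by (simp add: joukowski_power poly_monom)
      then show ?case using elim
        by (metis nonzero_mult_div_cancel_left mult_eq_0_iff poly_monom power_not_zero zero_neq_numeral)
    qed
  qed
  then have "half_sum_power n = Fraction_Field.Fract (monom 1 (2 * n) + 1) (monom 2 n)"
    using represents_half_sum_power by (metis represents_unique)
  then show ?thesis using rat_num_den_Fract[OF cop q0] that by metis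
qed

lemma rat_map_half_sum_power_Finite:
  assumes "n > 0"
  shows "rat_map (half_sum_power n) (Finite z) = (if z = 0 then Infty else Finite (joukowski (z ^ n)))"
proof -
  obtain c where c: "c \<noteq> 0" "rat_num (half_sum_power n) = smult c (monom 1 (2 * n) + 1)"
    "rat_den (half_sum_power n) = smult c (monom 2 n)"
    using half_sum_power_lowest_terms[OF assms] .
  have cp1_point: "rat_map (half_sum_power n) (Finite z) = cp1_point (c * (z ^ (2 * n) + 1)) (c * (2 * z ^ n))"
    by (simp add: rat_map_Finite_cp1_point c poly_monom del: rat_map.simps)
  show ?thesis
  proof (cases "z = 0")
    case False
    have "2 * z ^ n * joukowski (z ^ n) = z ^ (2 * n) + 1"
      using False by (rule joukowski_power)
    then have "(z ^ (2 * n) + 1) / (2 * z ^ n) = joukowski (z ^ n)"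
      using False by (metis nonzero_mult_div_cancel_left mult_eq_0_iff power_not_zero zero_neq_numeral)
    then show ?thesis unfolding cp1_point cp1_point_scale[OF c(1)] using False by (simp add: cp1_point_def)
  qed (unfold cp1_point, use assms in \<open>simp add: cp1_point_def power_0_left\<close>)
qed

lemma joukowski_sign: "c\<^sup>2 = 1 \<Longrightarrow> joukowski (c * s) = c * joukowski s"
proof -
  have "joukowski (- s) = (- (s + 1 / s)) / 2" by (simp add: joukowski_def)
  also have "\<dots> = - joukowski s" unfolding joukowski_def by (rule minus_divide_left[symmetric])
  finally show "c\<^sup>2 = 1 \<Longrightarrow> joukowski (c * s) = c * joukowski s" by (auto simp: power2_eq_1_iff)
qed

text \<open>
  Which of the two square roots is the value of \<^const>\<open>csqrt\<close> depends on \<open>s\<close>, but the pair of points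
  \<open>z \<plusminus> \<surd>(z\<^sup>2 - 1)\<close> over \<open>z = J(s)\<close> is \<open>s, 1/s\<close> in either case.
\<close>

lemma joukowski_preimages:
  assumes "s \<noteq> 0"
  shows "(joukowski s + csqrt ((joukowski s)\<^sup>2 - 1) = s \<and> joukowski s - csqrt ((joukowski s)\<^sup>2 - 1) = 1 / s)
    \<or> (joukowski s + csqrt ((joukowski s)\<^sup>2 - 1) = 1 / s \<and> joukowski s - csqrt ((joukowski s)\<^sup>2 - 1) = s)"
proof -
  \<comment> \<open>The number with \<open>J(s) \<plusminus> d = s\<^bsup>\<plusminus>1\<^esup>\<close>, a square root of \<open>J(s)\<^sup>2 - 1\<close>.\<close>
  define d where "d = (s - 1 / s) / 2"
  have sd: "joukowski s + d = s" "joukowski s - d = 1 / s"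
    by (simp_all add: joukowski_def d_def field_simps)
  have "(joukowski s + d) * (joukowski s - d) = 1" unfolding sd using assms by simp
  then have "(joukowski s)\<^sup>2 - 1 = d\<^sup>2" by (simp add: power2_eq_square algebra_simps)
  then have "(csqrt ((joukowski s)\<^sup>2 - 1))\<^sup>2 = d\<^sup>2" by simp
  then have "csqrt ((joukowski s)\<^sup>2 - 1) = d \<or> csqrt ((joukowski s)\<^sup>2 - 1) = - d"
    by (simp only: power2_eq_iff)
  then show ?thesis using sd by (elim disjE) (simp_all only:, simp_all)
qed

lemma joukowski_csqrt:
  fixes z :: complex
  defines "s \<equiv> z + csqrt (z\<^sup>2 - 1)"
  shows "s \<noteq> 0" "1 / s = z - csqrt (z\<^sup>2 - 1)" "joukowski s = z"
proof -
  have "s * (z - csqrt (z\<^sup>2 - 1)) = z\<^sup>2 - (csqrt (z\<^sup>2 - 1))\<^sup>2"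
    unfolding s_def by (simp add: power2_eq_square algebra_simps)
  then have *: "s * (z - csqrt (z\<^sup>2 - 1)) = 1" by simp
  then show "s \<noteq> 0" by auto
  show inv: "1 / s = z - csqrt (z\<^sup>2 - 1)"
    using * by (metis inverse_unique inverse_eq_divide)
  show "joukowski s = z" unfolding joukowski_def inv by (simp add: s_def)
qed

text \<open>
  The explicit formula with square roots says that \<open>A\<close> lifts through \<^const>\<open>joukowski\<close>. If
  \<open>R\<close> commutes with the inversion, the two summands of the formula are reciprocal to each other.
\<close>

lemma A_form_iff:
  assumes "R \<in> commuting_with_inversion"
  shows "A_form n \<epsilon> r R A \<longleftrightarrow>
    (\<forall>\<^sub>F s in cofinite. rat_eval A (joukowski s) = \<epsilon> ^ n * joukowski (s powi r * rat_eval R s ^ n))"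
    (is "?L \<longleftrightarrow> ?R")
proof -
  define \<Phi> where "\<Phi> = (\<lambda>w. w powi r * rat_eval R w ^ n)"
  define k where "k = (\<lambda>z :: complex. z + csqrt (z\<^sup>2 - 1))"
  have L: "?L \<longleftrightarrow> (\<forall>\<^sub>F z in cofinite. rat_eval A z = \<epsilon> ^ n / 2 * (\<Phi> (k z) + \<Phi> (z - csqrt (z\<^sup>2 - 1))))"
    by (simp add: A_form_def Let_def represents_iff_eval \<Phi>_def k_def)
  have recip: "\<forall>\<^sub>F s in cofinite. \<Phi> (1 / s) = 1 / \<Phi> s"
    using iffD1[OF commuting_with_inversion_iff[OF represents_eval] assms] generic_neq[of 0]
  proof (rule eventually_elim2)
    fix s :: complex assume s: "rat_eval R s * rat_eval R (1 / s) = 1" "s \<noteq> 0"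
    then have "rat_eval R (1 / s) = 1 / rat_eval R s" by (metis inverse_unique inverse_eq_divide)
    then show "\<Phi> (1 / s) = 1 / \<Phi> s" using s
      by (simp add: \<Phi>_def power_int_divide_distrib power_divide)
  qed
  show ?thesis
  proof
    assume ?L
    then have "\<forall>\<^sub>F s in cofinite. rat_eval A (joukowski s)
        = \<epsilon> ^ n / 2 * (\<Phi> (k (joukowski s)) + \<Phi> (joukowski s - csqrt ((joukowski s)\<^sup>2 - 1)))"
      unfolding L by (rule generic_compose[OF finite_fibres_joukowski])
    then show ?R
      using recip generic_neq[of 0]
    proof eventually_elim
      case (elim s)
      have "\<Phi> (k (joukowski s)) + \<Phi> (joukowski s - csqrt ((joukowski s)\<^sup>2 - 1)) = \<Phi> s + 1 / \<Phi> s"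
        using joukowski_preimages[OF elim(3)] elim(2) by (auto simp: k_def add.commute)
      then show ?case using elim(1) by (simp add: joukowski_def \<Phi>_def)
    qed
  next
    assume R: ?R
    have "inj k"
      by (rule inj_on_inverseI[of _ joukowski]) (simp add: k_def joukowski_csqrt)
    note kc = generic_compose[OF finite_fibres_inj[OF this]]
    show ?L
      unfolding L using kc[OF R] kc[OF recip]
    proof eventually_elim
      case (elim z)
      have J: "joukowski (k z) = z" "1 / k z = z - csqrt (z\<^sup>2 - 1)"
        by (simp_all add: k_def joukowski_csqrt)
      have "rat_eval A z = \<epsilon> ^ n * joukowski (\<Phi> (k z))" using elim(1) by (simp add: J(1) \<Phi>_def)
      also have "joukowski (\<Phi> (k z)) = (\<Phi> (k z) + \<Phi> (1 / k z)) / 2"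
        unfolding elim(2) by (simp add: joukowski_def)
      finally show ?case unfolding J(2) by simp
    qed
  qed
qed

text \<open>
  Both parts of the classification come down to this lemma: any lift of \<open>A\<close> through
  \<^const>\<open>joukowski\<close> that has the shape \<open>s\<^sup>k R\<^sub>0(s)\<^sup>n\<close> can be normalised. The exponent \<open>k\<close> is a natural number,
  because negative exponents can be absorbed into \<open>R\<^sub>0\<close>, \<open>k\<close> being determined modulo \<open>n\<close> only.
\<close>

lemma joukowski_lift_classification:
  assumes n: "n > 2" "coprime k n"
    and R0: "represents R0 h" "R0 \<noteq> 0"
    and A: "\<forall>\<^sub>F s in cofinite. rat_eval A (joukowski s) = joukowski (s ^ k * h s ^ n)"
  obtains R \<epsilon> where "R \<in> commuting_with_inversion" "\<epsilon> ^ (2 * n) = 1"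
    "represents R (\<lambda>s. h s / \<epsilon>)" "A_form n \<epsilon> (int k) R A"
proof -
  have repX: "represents (inverse ratX) (\<lambda>z. 1 / z)"
    using represents_inverse[OF represents_ratX] by (simp add: field_simps)
  obtain S where S: "represents S (\<lambda>s. h (1 / s))"
    using ex_represents_comp[OF R0(1) repX finite_fibres_inverse] by blast
  define X Y where "X = ratX ^ k * R0 ^ n" and "Y = inverse ratX ^ k * S ^ n"
  have repXY: "represents X (\<lambda>s. s ^ k * h s ^ n)" "represents Y (\<lambda>s. (1 / s) ^ k * h (1 / s) ^ n)"
    unfolding X_def Y_def
    by (intro represents_mult represents_power represents_ratX R0 repX S)+
  have h0: "\<forall>\<^sub>F s in cofinite. h s \<noteq> 0" by (rule represents_nonzero[OF R0])
  \<comment> \<open>In the field of rational functions one of the two factors vanishes identically.\<close>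
  have "represents ((X - Y) * (X * Y - 1)) (\<lambda>s. 0)"
  proof -
    have "represents ((X - Y) * (X * Y - 1))
        (\<lambda>s. (s ^ k * h s ^ n - ((1 / s) ^ k * h (1 / s) ^ n))
          * ((s ^ k * h s ^ n) * ((1 / s) ^ k * h (1 / s) ^ n) - 1))"
      by (intro represents_mult represents_diff repXY represents_1)
    then show ?thesis
    proof (rule represents_cong)
      show "\<forall>\<^sub>F s in cofinite. (s ^ k * h s ^ n - ((1 / s) ^ k * h (1 / s) ^ n))
          * ((s ^ k * h s ^ n) * ((1 / s) ^ k * h (1 / s) ^ n) - 1) = 0"
        using A generic_compose[OF finite_fibres_inverse A] h0
          generic_compose[OF finite_fibres_inverse h0] generic_neq[of 0]
      proof eventually_elim
        case (elim s)
        let ?x = "s ^ k * h s ^ n" and ?y = "(1 / s) ^ k * h (1 / s) ^ n"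
        have eq: "joukowski ?x = joukowski ?y" using elim(1,2) by (simp add: joukowski_inverse)
        have "?x \<noteq> 0" "?y \<noteq> 0" using elim(3-5) by simp_all
        then have diff: "(?x - ?y) * (?x * ?y - 1) = 2 * ?x * ?y * (joukowski ?x - joukowski ?y)"
          by (rule joukowski_diff)
        show ?case unfolding diff eq by (simp only: diff_self mult_zero_right)
      qed
    qed
  qed
  then have "(X - Y) * (X * Y - 1) = 0" using represents_0 by (rule represents_unique)
  then have "X = Y \<or> X * Y = 1" by simp
  moreover have "X \<noteq> Y"
  proof
    assume "X = Y"
    have "ratX ^ (k + k) * R0 ^ n = ratX ^ k * X" by (simp add: X_def power_add mult.assoc)
    also have "\<dots> = (ratX ^ k * inverse ratX ^ k) * S ^ n"
      unfolding \<open>X = Y\<close> Y_def by (simp only: mult.assoc)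
    also have "\<dots> = S ^ n" by (simp only: ratX_power_inverse mult_1_left)
    finally have "ratX ^ (k + k) * R0 ^ n = S ^ n" .
    then have "ratX ^ (k + k) = (S / R0) ^ n"
      using R0(2) by (simp only: power_divide) (simp add: eq_divide_eq)
    then have "n dvd k + k" by (rule ratX_power_eq_power_dvd)
    then have "n dvd 2 * k" by (simp add: mult_2)
    then have "n dvd 2" using n(2) by (simp add: coprime_commute coprime_dvd_mult_left_iff)
    then show False using n(1) by (auto dest: dvd_imp_le)
  qed
  ultimately have XY: "X * Y = 1" by simp
  have "X * Y = (ratX ^ k * inverse ratX ^ k) * (R0 * S) ^ n"
    by (simp only: X_def Y_def power_mult_distrib ac_simps)
  then have "(R0 * S) ^ n = 1" using XY by (simp only: ratX_power_inverse mult_1_left)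
  then obtain c where c: "c ^ n = 1" "represents (R0 * S) (\<lambda>z. c)"
    by (rule ratfun_root_of_unity_constant) (use n in simp)
  define \<epsilon> where "\<epsilon> = csqrt c"
  have eps: "\<epsilon>\<^sup>2 = c" by (simp add: \<epsilon>_def)
  then have eps2n: "\<epsilon> ^ (2 * n) = 1" using c(1) by (simp add: power_mult)
  have eps0: "\<epsilon> \<noteq> 0" using eps2n n(1) by (auto simp: power_0_left)
  define R where "R = R0 / Fraction_Field.Fract [:\<epsilon>:] 1"
  have R: "represents R (\<lambda>s. h s / \<epsilon>)"
    unfolding R_def by (intro represents_divide R0 represents_const)
  have "\<forall>\<^sub>F s in cofinite. h s * h (1 / s) = c"
    by (rule represents_generic_eq[OF represents_mult[OF R0(1) S] c(2)])
  then have "\<forall>\<^sub>F s in cofinite. (h s / \<epsilon>) * (h (1 / s) / \<epsilon>) = 1"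
    by eventually_elim (use eps eps0 in \<open>auto simp: power2_eq_square\<close>)
  then have comm: "R \<in> commuting_with_inversion"
    using commuting_with_inversion_iff[OF R] by simp
  have "A_form n \<epsilon> (int k) R A"
    unfolding A_form_iff[OF comm] using A R[unfolded represents_iff_eval]
  proof eventually_elim
    case (elim s)
    have "(\<epsilon> ^ n)\<^sup>2 = 1" using eps2n by (metis mult.commute power_mult)
    then have "\<epsilon> ^ n * joukowski (s ^ k * rat_eval R s ^ n) = joukowski (\<epsilon> ^ n * (s ^ k * rat_eval R s ^ n))"
      by (rule joukowski_sign[symmetric])
    also have "\<epsilon> ^ n * (s ^ k * rat_eval R s ^ n) = s ^ k * h s ^ n"
      unfolding elim(2) power_divide using eps0 by simp
    finally show ?case using elim(1) by simp
  qed
  with comm eps2n R show ?thesis by (rule that)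
qed


section \<open>Good solutions have the stated form\<close>

text \<open>
  Both sides are rational maps, so the equation may be checked at generic points.
\<close>

lemma semiconjugacy_generic:
  assumes "n > 0" "nonconstant F"
  shows "rat_map A \<circ> rat_map (half_sum_power n) = rat_map (half_sum_power n) \<circ> rat_map F \<longleftrightarrow>
    (\<forall>\<^sub>F t in cofinite. rat_eval A (joukowski (t ^ n)) = joukowski (rat_eval F t ^ n))"
proof -
  have ff: "finite_fibres (rat_eval F)"
    using assms(2) nonconstant_iff_finite_fibres[OF represents_eval] by simp
  obtain L where L: "rat_map L = rat_map A \<circ> rat_map (half_sum_power n)"
    "represents L (\<lambda>t. rat_eval A (joukowski (t ^ n)))"
    using represents_composition[OF represents_eval represents_half_sum_power
        finite_fibres_half_sum_power[OF assms(1)]] .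
  obtain M where M: "rat_map M = rat_map (half_sum_power n) \<circ> rat_map F"
    "represents M (\<lambda>t. joukowski (rat_eval F t ^ n))"
    using represents_composition[OF represents_half_sum_power represents_eval ff] .
  show ?thesis
  proof
    assume eq: "rat_map A \<circ> rat_map (half_sum_power n) = rat_map (half_sum_power n) \<circ> rat_map F"
    then have "represents L (\<lambda>t. joukowski (rat_eval F t ^ n))"
      using L(1) M unfolding represents_def by simp
    with L(2) show "\<forall>\<^sub>F t in cofinite. rat_eval A (joukowski (t ^ n)) = joukowski (rat_eval F t ^ n)"
      by (rule represents_generic_eq)
  next
    assume "\<forall>\<^sub>F t in cofinite. rat_eval A (joukowski (t ^ n)) = joukowski (rat_eval F t ^ n)"
    from represents_unique[OF represents_cong[OF L(2) this] M(2)] L(1) M(1)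
    show "rat_map A \<circ> rat_map (half_sum_power n) = rat_map (half_sum_power n) \<circ> rat_map F" by simp
  qed
qed

text \<open>
  If \<open>\<omega>\<close> has order \<open>m\<close>, invariance makes \<open>F\<close> a function of \<open>t\<^sup>m\<close>, and so is \<open>P\<close> because \<open>m\<close> divides \<open>n\<close>.
\<close>

lemma no_common_right_factor_imp_not_rotation_invariant:
  assumes "n > 0" and nc: "no_common_right_factor (half_sum_power n) F"
    and \<omega>: "\<omega> ^ n = 1" "\<omega> \<noteq> 1"
  shows "\<not> (\<forall>\<^sub>F t in cofinite. rat_eval F (\<omega> * t) = rat_eval F t)"
proof
  assume inv: "\<forall>\<^sub>F t in cofinite. rat_eval F (\<omega> * t) = rat_eval F t"
  obtain m where m: "m > 0" "\<omega> ^ m = 1" "\<And>i. \<omega> ^ i = 1 \<Longrightarrow> m dvd i"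
    using multiplicative_order[OF \<omega>(1) assms(1)] by blast
  obtain H where H: "represents F (\<lambda>z. rat_eval H (z ^ m))"
    using rotation_invariant_imp_function_of_power[OF m(2,1,3) represents_eval inv] by blast
  obtain l where l: "n = m * l" using m(3)[OF \<omega>(1)] by (elim dvdE)
  note X = represents_power[OF represents_ratX, of m] finite_fibres_power[OF m(1)]
  have "rat_map F = rat_map H \<circ> rat_map (ratX ^ m)"
    by (rule rat_map_comp_eq[OF represents_eval X H])
  moreover have "rat_map (half_sum_power n) = rat_map (half_sum_power l) \<circ> rat_map (ratX ^ m)"
    by (rule rat_map_comp_eq[OF represents_half_sum_power X])
      (use represents_half_sum_power[of n] in \<open>simp add: l power_mult\<close>)
  ultimately have "rat_degree (ratX ^ m) = 1"
    using nc unfolding no_common_right_factor_def by blast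
  then have "m = 1" by (simp add: rat_degree_ratX_power)
  then show False using m(2) \<omega>(2) by simp
qed

text \<open>
  The semiconjugacy leaves two possibilities, \<open>F(\<zeta>t)F(t)\<close> constant or \<open>F(\<zeta>t)/F(t)\<close> constant. In the first
  case \<open>F\<close> is invariant under \<open>\<zeta>\<^sup>2\<close>, which is not \<open>1\<close> as \<open>n > 2\<close>. In the second the constant is \<open>\<zeta>\<^sup>k\<close>, and
  a common divisor \<open>d > 1\<close> of \<open>k\<close> and \<open>n\<close> would make \<open>F\<close> invariant under \<open>\<zeta>\<^bsup>n/d\<^esup>\<close>.
\<close>

lemma good_solution_rotation:
  assumes n: "n > 2" and F: "nonconstant F" "no_common_right_factor (half_sum_power n) F"
    and semi: "\<forall>\<^sub>F t in cofinite. rat_eval A (joukowski (t ^ n)) = joukowski (rat_eval F t ^ n)"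
    and \<zeta>: "\<zeta> ^ n = 1" "\<And>i. \<zeta> ^ i = 1 \<Longrightarrow> n dvd i" "\<And>c. c ^ n = 1 \<Longrightarrow> \<exists>k. c = \<zeta> ^ k"
  obtains k where "coprime k n" "\<forall>\<^sub>F t in cofinite. rat_eval F (\<zeta> * t) = \<zeta> ^ k * rat_eval F t"
proof -
  define f where "f = rat_eval F"
  have repF: "represents F f" unfolding f_def by (rule represents_eval)
  have ff: "finite_fibres f" using F(1) nonconstant_iff_finite_fibres[OF repF] by simp
  have z0: "\<zeta> \<noteq> 0" using \<zeta>(1) n by (auto simp: power_0_left)
  note rot = generic_compose[OF finite_fibres_scale[OF z0]]
  have f0: "\<forall>\<^sub>F t in cofinite. f t \<noteq> 0" by (rule finite_fibresD[OF ff])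
  have F0: "F \<noteq> 0" by (rule finite_fibres_imp_nonzero[OF repF ff])
  note not_inv = no_common_right_factor_imp_not_rotation_invariant[OF _ F(2), folded f_def]
  obtain G where G: "represents G (\<lambda>t. f (\<zeta> * t))"
    using ex_represents_comp[OF repF represents_rotation finite_fibres_scale[OF z0]] by blast
  have "represents ((G ^ n - F ^ n) * (G ^ n * F ^ n - 1))
      (\<lambda>t. (f (\<zeta> * t) ^ n - f t ^ n) * (f (\<zeta> * t) ^ n * f t ^ n - 1))"
    by (intro represents_mult represents_diff represents_power repF G represents_1)
  moreover have "\<forall>\<^sub>F t in cofinite. (f (\<zeta> * t) ^ n - f t ^ n) * (f (\<zeta> * t) ^ n * f t ^ n - 1) = 0"
    using semi rot[OF semi] f0 rot[OF f0]
  proof eventually_elim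
    case (elim t)
    have eq: "joukowski (f (\<zeta> * t) ^ n) = joukowski (f t ^ n)"
      using elim(1,2) \<zeta>(1) by (simp add: f_def power_mult_distrib)
    have "f (\<zeta> * t) ^ n \<noteq> 0" "f t ^ n \<noteq> 0" using elim(3,4) by simp_all
    from joukowski_diff[OF this] show ?case unfolding eq by simp
  qed
  ultimately have "represents ((G ^ n - F ^ n) * (G ^ n * F ^ n - 1)) (\<lambda>t. 0)"
    by (rule represents_cong)
  then have "(G ^ n - F ^ n) * (G ^ n * F ^ n - 1) = 0" using represents_0 by (rule represents_unique)
  then have "(G * F) ^ n = 1 \<or> (G / F) ^ n = 1"
    using F0 by (auto simp: power_mult_distrib power_divide)
  then show ?thesis
  proof
    assume "(G * F) ^ n = 1"
    then obtain c where c: "c ^ n = 1" "represents (G * F) (\<lambda>t. c)"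
      by (rule ratfun_root_of_unity_constant) (use n in simp)
    have swap: "\<forall>\<^sub>F t in cofinite. f (\<zeta> * t) * f t = c"
      by (rule represents_generic_eq[OF represents_mult[OF G repF] c(2)])
    have "\<forall>\<^sub>F t in cofinite. f (\<zeta>\<^sup>2 * t) = f t"
      using swap rot[OF swap] rot[OF f0]
    proof eventually_elim
      case (elim t)
      then have "f (\<zeta> * (\<zeta> * t)) * f (\<zeta> * t) = f t * f (\<zeta> * t)" by (simp add: mult.commute)
      then show ?case using elim(3) by (simp add: power2_eq_square mult.assoc)
    qed
    moreover have "(\<zeta>\<^sup>2) ^ n = 1" using \<zeta>(1) by (metis mult.commute power_mult power_one)
    moreover have "\<zeta>\<^sup>2 \<noteq> 1" using \<zeta>(2)[of 2] n dvd_imp_le[of n 2] by auto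
    ultimately show ?thesis using not_inv[of "\<zeta>\<^sup>2"] n by simp
  next
    assume "(G / F) ^ n = 1"
    then obtain c where c: "c ^ n = 1" "represents (G / F) (\<lambda>t. c)"
      by (rule ratfun_root_of_unity_constant) (use n in simp)
    obtain k where k: "c = \<zeta> ^ k" using \<zeta>(3)[OF c(1)] by blast
    have "\<forall>\<^sub>F t in cofinite. f (\<zeta> * t) / f t = \<zeta> ^ k"
      unfolding k[symmetric] by (rule represents_generic_eq[OF represents_divide[OF G repF] c(2)])
    then have step: "\<forall>\<^sub>F t in cofinite. f (\<zeta> * t) = \<zeta> ^ k * f t"
      using f0 by eventually_elim (simp add: divide_eq_eq)
    have iter: "\<forall>\<^sub>F t in cofinite. f (\<zeta> ^ j * t) = \<zeta> ^ (k * j) * f t" for j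
    proof (induction j)
      case (Suc j)
      show ?case using rot[OF Suc] step
        by eventually_elim (simp add: power_add ac_simps)
    qed simp
    have "coprime k n"
    proof (rule ccontr)
      assume "\<not> coprime k n"
      define d where "d = gcd k n"
      have d: "d \<noteq> 1" "d dvd k" "d dvd n" "d > 0"
        using \<open>\<not> coprime k n\<close> n by (auto simp: d_def coprime_iff_gcd_eq_1)
      define j where "j = n div d"
      have nj: "n = d * j" using d(3) by (simp add: j_def)
      obtain k' where k': "k = d * k'" using d(2) by (elim dvdE)
      have "\<zeta> ^ (k * j) = (\<zeta> ^ n) ^ k'" unfolding k' nj by (simp add: ac_simps flip: power_mult)
      then have "\<zeta> ^ (k * j) = 1" using \<zeta>(1) by simp
      then have "\<forall>\<^sub>F t in cofinite. f (\<zeta> ^ j * t) = f t" using iter[of j] by simp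
      moreover have "(\<zeta> ^ j) ^ n = 1" using \<zeta>(1) by (metis mult.commute power_mult power_one)
      moreover have "\<zeta> ^ j \<noteq> 1"
      proof
        assume "\<zeta> ^ j = 1"
        then have "n dvd j" by (rule \<zeta>(2))
        moreover have "0 < j" "j < n" using nj n d(1,4) by (auto intro!: gr0I)
        ultimately show False by (auto dest: dvd_imp_le)
      qed
      ultimately show False using not_inv[of "\<zeta> ^ j"] n by simp
    qed
    then show ?thesis using step unfolding f_def by (rule that)
  qed
qed

lemma good_solution_imp_forms:
  assumes n: "n > 2" and good: "good_solution A (half_sum_power n) (half_sum_power n) F"
  shows "\<exists>R \<in> commuting_with_inversion. \<exists>(r :: int) \<epsilon>.
    gcd r (int n) = 1 \<and> \<epsilon> ^ (2 * n) = 1 \<and> F_form n \<epsilon> r R F \<and> A_form n \<epsilon> r R A"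
proof -
  have F: "nonconstant F" "no_common_right_factor (half_sum_power n) F"
    and semi0: "rat_map A \<circ> rat_map (half_sum_power n) = rat_map (half_sum_power n) \<circ> rat_map F"
    using good by (simp_all add: good_solution_def)
  have n0: "n > 0" using n by simp
  have semi: "\<forall>\<^sub>F t in cofinite. rat_eval A (joukowski (t ^ n)) = joukowski (rat_eval F t ^ n)"
    using semi0 semiconjugacy_generic[OF n0 F(1)] by simp
  obtain \<zeta> :: complex where \<zeta>: "\<zeta> ^ n = 1" "\<And>i. \<zeta> ^ i = 1 \<Longrightarrow> n dvd i"
    "\<And>c. c ^ n = 1 \<Longrightarrow> \<exists>k. c = \<zeta> ^ k"
    using primitive_root_of_unity[OF n0] by blast
  obtain k where k: "coprime k n"
    "\<forall>\<^sub>F t in cofinite. rat_eval F (\<zeta> * t) = \<zeta> ^ k * rat_eval F t"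
    using good_solution_rotation[OF n F semi \<zeta>] .
  have z0: "\<zeta> \<noteq> 0" using \<zeta>(1) n by (auto simp: power_0_left)
  have "represents (F / ratX ^ k) (\<lambda>t. rat_eval F t / t ^ k)"
    by (intro represents_divide represents_power represents_eval represents_ratX)
  moreover have "\<forall>\<^sub>F t in cofinite. rat_eval F (\<zeta> * t) / (\<zeta> * t) ^ k = rat_eval F t / t ^ k"
    using k(2) by eventually_elim (use z0 in \<open>simp add: power_mult_distrib\<close>)
  ultimately obtain R0 where "represents (F / ratX ^ k) (\<lambda>t. rat_eval R0 (t ^ n))"
    using rotation_invariant_imp_function_of_power[OF \<zeta>(1) n0 \<zeta>(2)] by blast
  from represents_generic_eq[OF this]
  have "\<forall>\<^sub>F t in cofinite. rat_eval R0 (t ^ n) = rat_eval F t / t ^ k"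
    using \<open>represents (F / ratX ^ k) (\<lambda>t. rat_eval F t / t ^ k)\<close> by blast
  with generic_neq[of 0] have Feq: "\<forall>\<^sub>F t in cofinite. rat_eval F t = t ^ k * rat_eval R0 (t ^ n)"
    by eventually_elim simp
  have "R0 \<noteq> 0"
  proof
    assume "R0 = 0"
    then have "\<forall>\<^sub>F s in cofinite. rat_eval R0 s = 0"
      using represents_generic_eq[OF represents_eval represents_0] by simp
    from generic_compose[OF finite_fibres_power[OF n0] this] Feq
    have "\<forall>\<^sub>F t in cofinite. rat_eval F t = 0" by eventually_elim simp
    moreover have "\<forall>\<^sub>F t in cofinite. rat_eval F t \<noteq> 0"
      using F(1) nonconstant_iff_finite_fibres[OF represents_eval, of F] finite_fibresD by blast
    ultimately have "\<forall>\<^sub>F t :: complex in cofinite. False" by eventually_elim simp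
    then show False by (rule ex_generic)
  qed
  have "\<forall>\<^sub>F t in cofinite. rat_eval A (joukowski (t ^ n))
      = joukowski ((t ^ n) ^ k * rat_eval R0 (t ^ n) ^ n)"
    using semi Feq
    by eventually_elim (simp add: power_mult_distrib mult.commute flip: power_mult)
  then have "\<forall>\<^sub>F s in cofinite. rat_eval A (joukowski s) = joukowski (s ^ k * rat_eval R0 s ^ n)"
    using n0 by (rule generic_power_descend)
  from joukowski_lift_classification[OF n k(1) represents_eval \<open>R0 \<noteq> 0\<close> this]
  obtain R \<epsilon> where R: "R \<in> commuting_with_inversion" "\<epsilon> ^ (2 * n) = 1"
    "represents R (\<lambda>s. rat_eval R0 s / \<epsilon>)" "A_form n \<epsilon> (int k) R A" .
  have "\<epsilon> \<noteq> 0" using R(2) n by (auto simp: power_0_left)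
  have "F_form n \<epsilon> (int k) R F"
    unfolding F_form_def represents_iff_eval
    using Feq generic_compose[OF finite_fibres_power[OF n0] R(3)[unfolded represents_iff_eval]]
    by eventually_elim (use \<open>\<epsilon> \<noteq> 0\<close> in simp)
  moreover have "gcd (int k) (int n) = 1"
    using k(1) by (metis coprime_iff_gcd_eq_1 gcd_int_int_eq of_nat_1)
  ultimately show ?thesis
    using R by (intro bexI[of _ R] exI[of _ "int k"] exI[of _ \<epsilon>] conjI)
qed


section \<open>The stated form gives good solutions\<close>

context
  fixes n :: nat and r :: int and \<epsilon> :: complex and R A F :: ratfun and f :: "complex \<Rightarrow> complex"
  assumes n: "n > 2" and R: "R \<in> commuting_with_inversion" and r: "gcd r (int n) = 1"
    and \<epsilon>: "\<epsilon> ^ (2 * n) = 1" and F: "F_form n \<epsilon> r R F" and A: "A_form n \<epsilon> r R A"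
  defines "f \<equiv> rat_eval F"
begin

lemma n_pos: "n > 0" using n by simp

lemma eps_nonzero: "\<epsilon> \<noteq> 0" using \<epsilon> n by (auto simp: power_0_left)

lemma F_generic: "\<forall>\<^sub>F t in cofinite. f t = \<epsilon> * t powi r * rat_eval R (t ^ n)"
  using F by (simp add: F_form_def represents_iff_eval f_def)

lemma R_reciprocal: "\<forall>\<^sub>F s in cofinite. rat_eval R s * rat_eval R (1 / s) = 1"
  using iffD1[OF commuting_with_inversion_iff[OF represents_eval] R] .

lemma F_rotation:
  assumes "\<omega> ^ n = 1"
  shows "\<forall>\<^sub>F t in cofinite. f (\<omega> * t) = \<omega> powi r * f t"
proof -
  have "\<omega> \<noteq> 0" using assms n by (auto simp: power_0_left)
  from F_generic generic_compose[OF finite_fibres_scale[OF this] F_generic] show ?thesis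
    by eventually_elim (simp add: power_mult_distrib power_int_mult_distrib assms)
qed

lemma F_inversion: "\<forall>\<^sub>F t in cofinite. f (1 / t) * f t = \<epsilon>\<^sup>2"
  using F_generic generic_compose[OF finite_fibres_inverse F_generic] generic_neq[of 0]
    generic_compose[OF finite_fibres_power[OF n_pos] R_reciprocal]
proof eventually_elim
  case (elim t)
  have "(1 / t) powi r * t powi r = 1"
    using elim(3) by (simp add: power_int_divide_distrib)
  moreover have "f (1 / t) * f t = \<epsilon>\<^sup>2 * ((1 / t) powi r * t powi r)
      * (rat_eval R (t ^ n) * rat_eval R (1 / t ^ n))"
    unfolding elim(1,2) by (simp add: power_one_over power2_eq_square)
  ultimately show ?case using elim(4) by simp
qed

lemma F_nonzero: "\<forall>\<^sub>F t in cofinite. f t \<noteq> 0"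
  using F_inversion by eventually_elim (use eps_nonzero in auto)

lemma F_nonconstant: "nonconstant F"
proof (rule ccontr)
  assume "\<not> nonconstant F"
  then obtain c where c: "\<forall>\<^sub>F t in cofinite. f t = c"
    using constant_generic[OF represents_eval] unfolding f_def by blast
  obtain \<zeta> :: complex where \<zeta>: "\<zeta> ^ n = 1" "\<And>i. \<zeta> ^ i = 1 \<Longrightarrow> n dvd i"
    using primitive_root_of_unity[OF n_pos] by metis
  have z0: "\<zeta> \<noteq> 0" using \<zeta>(1) n by (auto simp: power_0_left)
  have "\<forall>\<^sub>F t :: complex in cofinite. \<zeta> powi r = 1"
    using c generic_compose[OF finite_fibres_scale[OF z0] c] F_rotation[OF \<zeta>(1)] F_nonzero
    by eventually_elim simp
  then have "\<zeta> powi r = 1" by (rule ex_generic)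
  then have "\<zeta> = 1" by (rule root_of_unity_power_bij(1)[OF r n_pos \<zeta>(1)])
  then have "n dvd 1" using \<zeta>(2)[of 1] by simp
  then show False using n by simp
qed

lemma F_finite_fibres: "finite_fibres f"
  using F_nonconstant nonconstant_iff_finite_fibres[OF represents_eval, of F] by (simp add: f_def)

text \<open>
  The equivariance of \<open>F\<close> under the whole dihedral group, valid at one generic point for
  all group elements simultaneously.
\<close>

lemma F_dihedral:
  "\<forall>\<^sub>F t in cofinite. \<forall>\<omega>\<in>{\<omega>. \<omega> ^ n = 1}. f (\<omega> * t) = \<omega> powi r * f t \<and> f (\<omega> / t) = \<omega> powi r * \<epsilon>\<^sup>2 / f t"
proof (rule eventually_ball_finite)
  show "finite {\<omega>::complex. \<omega> ^ n = 1}" using n_pos by auto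
  show "\<forall>\<omega>\<in>{\<omega>. \<omega> ^ n = 1}. \<forall>\<^sub>F t in cofinite.
      f (\<omega> * t) = \<omega> powi r * f t \<and> f (\<omega> / t) = \<omega> powi r * \<epsilon>\<^sup>2 / f t"
  proof
    fix \<omega> :: complex assume "\<omega> \<in> {\<omega>. \<omega> ^ n = 1}"
    then have \<omega>: "\<omega> ^ n = 1" by simp
    show "\<forall>\<^sub>F t in cofinite. f (\<omega> * t) = \<omega> powi r * f t \<and> f (\<omega> / t) = \<omega> powi r * \<epsilon>\<^sup>2 / f t"
      using F_rotation[OF \<omega>] generic_compose[OF finite_fibres_inverse F_rotation[OF \<omega>]]
        F_inversion F_nonzero
    proof eventually_elim
      case (elim t)
      have "f (1 / t) = \<epsilon>\<^sup>2 / f t" using elim(3,4) by (simp add: eq_divide_eq)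
      then show ?case using elim(1,2) by simp
    qed
  qed
qed

text \<open>
  The fixed points of the elements \<open>y \<mapsto> \<omega> \<epsilon>\<^sup>2/y\<close> satisfy \<open>y\<^sup>2\<^sup>n = 1\<close>. Away from them, and from \<open>0\<close>, the \<open>2n\<close>
  images of \<open>F(t)\<close> under the group are distinct.
\<close>

lemma F_generic_orbit: "\<forall>\<^sub>F t in cofinite. f t ^ (2 * n) \<noteq> 1"
  using finite_fibresD[OF finite_fibres_comp[OF finite_fibres_power F_finite_fibres]] n_pos by simp

lemma semiconjugacy:
  "\<forall>\<^sub>F t in cofinite. rat_eval A (joukowski (t ^ n)) = joukowski (f t ^ n)"
  using generic_compose[OF finite_fibres_power[OF n_pos] iffD1[OF A_form_iff[OF R] A]] F_generic
proof eventually_elim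
  case (elim t)
  have "(\<epsilon> ^ n)\<^sup>2 = 1" using \<epsilon> by (metis mult.commute power_mult)
  then have "\<epsilon> ^ n * joukowski ((t ^ n) powi r * rat_eval R (t ^ n) ^ n)
      = joukowski (\<epsilon> ^ n * ((t ^ n) powi r * rat_eval R (t ^ n) ^ n))"
    by (rule joukowski_sign[symmetric])
  moreover have "(t ^ n) powi r = (t powi r) ^ n"
    by (metis mult.commute power_int_mult power_int_of_nat)
  ultimately show ?case using elim by (simp add: power_mult_distrib mult.assoc)
qed

text \<open>
  Fix a generic \<open>t\<close> and put \<open>x = P(t)\<close>. The polynomial \<open>a(x, y)\<close> in \<open>y\<close> vanishes at \<open>F(\<sigma>(t))\<close> for all \<open>\<sigma>\<close> in the
  dihedral group, since \<open>P(\<sigma>(t)) = x\<close>. These are all the solutions of \<open>y\<^sup>n = F(t)\<^sup>n\<close> and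
  \<open>y\<^sup>n = F(t)\<^sup>-\<^sup>n\<close>, and there are \<open>2n\<close> of them.
\<close>

lemma curve_factor_degree:
  assumes "a \<noteq> 0" and vanish: "\<forall>\<^sub>F t in cofinite. poly (poly a [:f t:]) (joukowski (t ^ n)) = 0"
  shows "2 * n \<le> degree a"
proof -
  have "lead_coeff a \<noteq> 0" using assms(1) by simp
  note lead = generic_compose[OF finite_fibres_half_sum_power[OF n_pos] generic_poly_nonzero[OF this]]
  have "\<forall>\<^sub>F t in cofinite. \<forall>\<omega>\<in>{\<omega>. \<omega> ^ n = 1}.
      poly (poly a [:f (\<omega> * t):]) (joukowski ((\<omega> * t) ^ n)) = 0
      \<and> poly (poly a [:f (\<omega> / t):]) (joukowski ((\<omega> / t) ^ n)) = 0"
  proof (rule eventually_ball_finite)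
    show "finite {\<omega>::complex. \<omega> ^ n = 1}" using n_pos by auto
    show "\<forall>\<omega>\<in>{\<omega>. \<omega> ^ n = 1}. \<forall>\<^sub>F t in cofinite.
      poly (poly a [:f (\<omega> * t):]) (joukowski ((\<omega> * t) ^ n)) = 0
      \<and> poly (poly a [:f (\<omega> / t):]) (joukowski ((\<omega> / t) ^ n)) = 0"
    proof
      fix \<omega> :: complex assume "\<omega> \<in> {\<omega>. \<omega> ^ n = 1}"
      then have "\<omega> \<noteq> 0" using n_pos by (auto simp: power_0_left)
      note scale = generic_compose[OF finite_fibres_scale[OF this] vanish]
      show "\<forall>\<^sub>F t in cofinite. poly (poly a [:f (\<omega> * t):]) (joukowski ((\<omega> * t) ^ n)) = 0
          \<and> poly (poly a [:f (\<omega> / t):]) (joukowski ((\<omega> / t) ^ n)) = 0"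
        using scale generic_compose[OF finite_fibres_inverse scale] by eventually_elim simp
    qed
  qed
  with F_dihedral lead F_nonzero F_generic_orbit
  have "\<forall>\<^sub>F t :: complex in cofinite. 2 * n \<le> degree a"
  proof eventually_elim
    case (elim t)
    define x where "x = joukowski (t ^ n)"
    define b where "b = map_poly (\<lambda>p. poly p x) a"
    have eval_b: "poly b y = poly (poly a [:y:]) x" for y
      unfolding b_def by (induction a) (simp_all add: map_poly_pCons)
    have "coeff b (degree a) \<noteq> 0"
      using elim(2) by (simp add: b_def coeff_map_poly x_def)
    then have "b \<noteq> 0" by auto
    have "degree b \<le> degree a" 
      by (intro degree_le) (simp add: b_def coeff_map_poly coeff_eq_0)
    have orbit: "joukowski ((\<omega> * t) ^ n) = x" "joukowski ((\<omega> / t) ^ n) = x" if "\<omega> ^ n = 1" for \<omega>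
      using that joukowski_inverse[of "t ^ n"] by (simp_all add: x_def power_mult_distrib power_divide)
    have "{y. y ^ n = f t ^ n} \<union> {y. y ^ n = 1 / f t ^ n} \<subseteq> {y. poly b y = 0}"
    proof
      fix y assume "y \<in> {y. y ^ n = f t ^ n} \<union> {y. y ^ n = 1 / f t ^ n}"
      then show "y \<in> {y. poly b y = 0}"
      proof
        assume "y \<in> {y. y ^ n = f t ^ n}"
        then have "(y / f t) ^ n = 1" using elim(3) by (simp add: power_divide)
        from root_of_unity_power_bij(2)[OF r n_pos this]
        obtain \<omega> where \<omega>: "\<omega> ^ n = 1" "\<omega> powi r = y / f t" by blast
        have "f (\<omega> * t) = y" using elim(1,3) \<omega> by simp
        then show ?thesis using elim(5) \<omega>(1) orbit(1)[OF \<omega>(1)] by (auto simp: eval_b)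
      next
        assume "y \<in> {y. y ^ n = 1 / f t ^ n}"
        then have "(y * f t / \<epsilon>\<^sup>2) ^ n = 1"
          using elim(3) \<epsilon> by (simp add: power_divide power_mult_distrib flip: power_mult)
        from root_of_unity_power_bij(2)[OF r n_pos this]
        obtain \<omega> where \<omega>: "\<omega> ^ n = 1" "\<omega> powi r = y * f t / \<epsilon>\<^sup>2" by blast
        have "f (\<omega> / t) = y" using elim(1,3) \<omega> eps_nonzero by simp
        then show ?thesis using elim(5) \<omega>(1) orbit(2)[OF \<omega>(1)] by (auto simp: eval_b)
      qed
    qed
    then have "card ({y. y ^ n = f t ^ n} \<union> {y. y ^ n = 1 / f t ^ n}) \<le> card {y. poly b y = 0}"
      by (rule card_mono[OF poly_roots_finite[OF \<open>b \<noteq> 0\<close>]])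
    also have "card ({y. y ^ n = f t ^ n} \<union> {y. y ^ n = 1 / f t ^ n})
        = card {y. y ^ n = f t ^ n} + card {y. y ^ n = 1 / f t ^ n}"
    proof (rule card_Un_disjoint)
      have "f t ^ n * f t ^ n \<noteq> 1" using elim(4) by (simp only: mult_2 power_add) simp
      then have "f t ^ n \<noteq> 1 / f t ^ n" using elim(3) by (simp add: eq_divide_eq)
      then show "{y. y ^ n = f t ^ n} \<inter> {y. y ^ n = 1 / f t ^ n} = {}" by auto
    qed (use n_pos in auto)
    also have "\<dots> = 2 * n"
      using card_nth_roots[of "f t ^ n" n] card_nth_roots[of "1 / f t ^ n" n] elim(3) n_pos by simp
    also have "card {y. poly b y = 0} \<le> degree b" by (rule card_poly_roots_bound[OF \<open>b \<noteq> 0\<close>])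
    finally show ?case using \<open>degree b \<le> degree a\<close> by linarith
  qed
  then show ?thesis by (rule ex_generic)
qed

text \<open>
  The polynomial has degree \<open>2n\<close> in \<open>y\<close> and vanishes along \<open>(P(t), F(t))\<close>, so one of two factors does, and
  by the preceding lemma that factor has full degree in \<open>y\<close>. The other one is a polynomial in \<open>x\<close> dividing
  the coefficients of \<open>y\<^sup>n\<close> and \<open>y\<^sup>2\<^sup>n\<close>, which are constant multiples of the numerator and the
  denominator of \<open>A\<close>.
\<close>

lemma curve_irreducible: "irreducible_curve A (half_sum_power n)"
proof -
  let ?Q = "curve_poly A (half_sum_power n)"
  obtain c where c: "c \<noteq> 0" "rat_num (half_sum_power n) = smult c (monom 1 (2 * n) + 1)"
    "rat_den (half_sum_power n) = smult c (monom 2 n)"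
    using half_sum_power_lowest_terms[OF n_pos] .
  have coeffs: "coeff ?Q i = smult (coeff (rat_den (half_sum_power n)) i) (rat_num A)
      - smult (coeff (rat_num (half_sum_power n)) i) (rat_den A)" for i
    by (simp add: curve_poly_def coeff_map_poly)
  have top: "coeff ?Q (2 * n) = smult (- c) (rat_den A)"
    using n_pos by (simp add: coeffs c)
  have mid: "coeff ?Q n = smult (2 * c) (rat_num A)"
    using n_pos by (simp add: coeffs c mult.commute)
  have "coeff ?Q i = 0" if "i > 2 * n" for i
    using that n_pos by (simp add: coeffs c)
  then have deg_le: "degree ?Q \<le> 2 * n" by (intro degree_le) auto
  have "?Q \<noteq> 0" using top c(1) rat_den_nonzero[of A] by (metis coeff_0 neg_equal_0_iff_equal smult_eq_0_iff)
  have vanish: "\<forall>\<^sub>F t in cofinite. poly (poly ?Q [:f t:]) (joukowski (t ^ n)) = 0"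
    using semiconjugacy F_nonzero
      generic_compose[OF finite_fibres_half_sum_power[OF n_pos] rat_den_generic[of A]]
  proof eventually_elim
    case (elim t)
    let ?x = "joukowski (t ^ n)"
    have "poly (rat_num A) ?x = joukowski (f t ^ n) * poly (rat_den A) ?x"
      using elim(1,3) by (simp add: rat_eval_def divide_eq_eq)
    moreover have "2 * f t ^ n * joukowski (f t ^ n) = f t ^ (2 * n) + 1"
      using elim(2) by (rule joukowski_power)
    ultimately show ?case
      unfolding poly_curve_poly c by (simp add: poly_monom) (metis mult.commute)
  qed
  have unit: "is_unit b" if "?Q = a * b" "\<forall>\<^sub>F t in cofinite. poly (poly a [:f t:]) (joukowski (t ^ n)) = 0"
    for a b
  proof -
    have nz: "a \<noteq> 0" "b \<noteq> 0" using that(1) \<open>?Q \<noteq> 0\<close> by auto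
    have "degree a + degree b \<le> 2 * n"
      using deg_le that(1) degree_mult_eq[OF nz] by simp
    then have "degree b = 0" using curve_factor_degree[OF nz(1) that(2)] by simp
    then obtain b0 where b0: "b = [:b0:]" by (metis degree_eq_zeroE)
    have dvd: "b0 dvd coeff ?Q i" for i unfolding that(1) b0 by simp
    have "b0 dvd rat_den A" using dvd[of "2 * n"] c(1) unfolding top by (simp add: dvd_smult_iff)
    moreover have "b0 dvd rat_num A" using dvd[of n] c(1) unfolding mid by (simp add: dvd_smult_iff)
    ultimately have "is_unit b0" using coprime_rat_num_den[of A] by (meson coprime_common_divisor)
    then show ?thesis unfolding b0 by (simp add: is_unit_const_poly_iff)
  qed
  show ?thesis
    unfolding irreducible_curve_def
  proof (rule irreducibleI)
    show "?Q \<noteq> 0" by fact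
    show "\<not> is_unit ?Q"
    proof
      assume "is_unit ?Q"
      then obtain u where "?Q = [:u:]" unfolding is_unit_poly_iff by blast
      then have "coeff ?Q (2 * n) = 0" using n_pos by (simp add: coeff_pCons split: nat.splits)
      then show False unfolding top using c(1) rat_den_nonzero[of A] by simp
    qed
    fix a b assume ab: "?Q = a * b"
    have repP: "represents (half_sum_power n) (\<lambda>t. joukowski (t ^ n))"
      by (rule represents_half_sum_power)
    have repF: "represents F f" unfolding f_def by (rule represents_eval)
    obtain u v where u: "represents u (\<lambda>t. poly (poly a [:f t:]) (joukowski (t ^ n)))"
      and v: "represents v (\<lambda>t. poly (poly b [:f t:]) (joukowski (t ^ n)))"
      using represents_bivariate[OF repP repF] by metis
    have "represents (u * v) (\<lambda>t. 0)"
      using represents_cong[OF represents_mult[OF u v]] vanish unfolding ab by simp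
    then have "u * v = 0" using represents_0 by (rule represents_unique)
    then have "u = 0 \<or> v = 0" by simp
    then show "is_unit a \<or> is_unit b"
    proof
      assume "u = 0"
      from represents_generic_eq[OF u[unfolded this] represents_0] unit[OF ab] show ?thesis by simp
    next
      assume "v = 0"
      from represents_generic_eq[OF v[unfolded this] represents_0] unit[of b a] ab
      show ?thesis by (simp add: mult.commute)
    qed
  qed
qed

text \<open>
  A common factor \<open>w\<close> of degree at least \<open>2\<close> identifies a generic point \<open>t\<close> with some \<open>z \<noteq> t\<close>. Then
  \<open>P(z) = P(t)\<close> puts \<open>z\<close> into the orbit of \<open>t\<close>, and \<open>F(z) = F(t)\<close> contradicts the injectivity of \<open>F\<close> on that
  orbit.
\<close>

lemma no_common_factor: "no_common_right_factor (half_sum_power n) F"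
  unfolding no_common_right_factor_def
proof (intro allI impI, elim conjE)
  fix p' q' w
  assume P: "rat_map (half_sum_power n) = rat_map p' \<circ> rat_map w"
    and Q: "rat_map F = rat_map q' \<circ> rat_map w"
  have repF: "represents F f" unfolding f_def by (rule represents_eval)
  have "nonconstant w"
  proof (rule ccontr)
    assume "\<not> nonconstant w"
    then obtain c where "\<forall>\<^sub>F z in cofinite. rat_eval w z = c"
      using constant_generic[OF represents_eval] by blast
    then have "represents w (\<lambda>z. c)" by (simp add: represents_iff_eval)
    then have const: "\<forall>\<^sub>F z in cofinite. Finite (f z) = rat_map q' (Finite c)"
      using repF unfolding represents_def
      by eventually_elim (simp add: Q del: rat_map.simps)
    then obtain z0 where z0: "Finite (f z0) = rat_map q' (Finite c)" by (rule ex_generic)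
    have "\<forall>\<^sub>F z in cofinite. f z = f z0"
      using const by eventually_elim (metis z0 cp1.inject(1))
    with finite_fibresD[OF F_finite_fibres, of "f z0"] have "\<forall>\<^sub>F z :: complex in cofinite. False"
      by eventually_elim simp
    then show False by (rule ex_generic)
  qed
  show "rat_degree w = 1"
  proof (rule ccontr)
    assume "rat_degree w \<noteq> 1"
    then have "rat_degree w \<ge> 2" using \<open>nonconstant w\<close> by (simp add: nonconstant_def)
    have fin: "\<forall>\<^sub>F t in cofinite. \<forall>\<omega>\<in>{\<omega>. \<omega> ^ n = 1}.
        rat_map F (Finite (\<omega> * t)) = Finite (f (\<omega> * t)) \<and> rat_map F (Finite (\<omega> / t)) = Finite (f (\<omega> / t))"
    proof (rule eventually_ball_finite)
      show "finite {\<omega>::complex. \<omega> ^ n = 1}" using n_pos by auto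
      show "\<forall>\<omega>\<in>{\<omega>. \<omega> ^ n = 1}. \<forall>\<^sub>F t in cofinite.
        rat_map F (Finite (\<omega> * t)) = Finite (f (\<omega> * t)) \<and> rat_map F (Finite (\<omega> / t)) = Finite (f (\<omega> / t))"
      proof
        fix \<omega> :: complex assume "\<omega> \<in> {\<omega>. \<omega> ^ n = 1}"
        then have "\<omega> \<noteq> 0" using n_pos by (auto simp: power_0_left)
        note scale = generic_compose[OF finite_fibres_scale[OF this] repF[unfolded represents_def]]
        show "\<forall>\<^sub>F t in cofinite.
          rat_map F (Finite (\<omega> * t)) = Finite (f (\<omega> * t)) \<and> rat_map F (Finite (\<omega> / t)) = Finite (f (\<omega> / t))"
          using scale generic_compose[OF finite_fibres_inverse scale]
          by eventually_elim (simp del: rat_map.simps)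
      qed
    qed
    have "\<forall>\<^sub>F t :: complex in cofinite. False"
      using fin generic_second_preimage[OF \<open>rat_degree w \<ge> 2\<close>] F_dihedral F_nonzero F_generic_orbit
        generic_neq[of 0]
    proof eventually_elim
      case (elim t)
      obtain z where z: "z \<noteq> t" "rat_map w (Finite z) = rat_map w (Finite t)" using elim(2) by blast
      have "rat_map (half_sum_power n) (Finite z) = rat_map (half_sum_power n) (Finite t)"
        using z(2) by (simp add: P del: rat_map.simps)
      then have "z \<noteq> 0" and "joukowski (z ^ n) = joukowski (t ^ n)"
        using elim(6) by (auto simp: rat_map_half_sum_power_Finite[OF n_pos] simp del: rat_map.simps
            split: if_splits)
      then have zn: "z ^ n = t ^ n \<or> z ^ n = 1 / t ^ n"
        using joukowski_eq_iff[of "z ^ n" "t ^ n"] elim(6) by simp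
      have F_eq: "rat_map F (Finite z) = rat_map F (Finite t)"
        using z(2) by (simp add: Q del: rat_map.simps)
      have finite_F: "rat_map F (Finite (\<omega> * t)) = Finite (f (\<omega> * t))"
        "rat_map F (Finite (\<omega> / t)) = Finite (f (\<omega> / t))" if "\<omega> ^ n = 1" for \<omega>
        using elim(1) that by blast+
      have F_t: "rat_map F (Finite t) = Finite (f t)"
        using finite_F(1)[of 1] by (simp del: rat_map.simps)
      show False
        using zn
      proof
        assume "z ^ n = t ^ n"
        define \<omega> where "\<omega> = z / t"
        have \<omega>: "\<omega> ^ n = 1" "z = \<omega> * t"
          using \<open>z ^ n = t ^ n\<close> elim(6) by (simp_all add: \<omega>_def power_divide)
        have "f z = f t" using finite_F(1)[OF \<omega>(1)] F_eq F_t by (metis \<omega>(2) cp1.inject)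
        then have "\<omega> powi r * f t = f t" using elim(3) \<omega> by auto
        then have "\<omega> = 1" using elim(4) root_of_unity_power_bij(1)[OF r n_pos \<omega>(1)] by simp
        then show False using \<omega>(2) z(1) by simp
      next
        assume "z ^ n = 1 / t ^ n"
        define \<omega> where "\<omega> = z * t"
        have \<omega>: "\<omega> ^ n = 1" "z = \<omega> / t"
          using \<open>z ^ n = 1 / t ^ n\<close> elim(6) by (simp_all add: \<omega>_def power_mult_distrib)
        have "f z = f t" using finite_F(2)[OF \<omega>(1)] F_eq F_t by (metis \<omega>(2) cp1.inject)
        then have "\<omega> powi r * \<epsilon>\<^sup>2 / f t = f t" using elim(3) \<omega> by auto
        then have "f t * f t = \<omega> powi r * \<epsilon>\<^sup>2" using elim(4) by (simp add: divide_eq_eq)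
        then have "f t ^ (2 * n) = (\<omega> powi r * \<epsilon>\<^sup>2) ^ n" by (simp add: power_mult power2_eq_square)
        also have "\<dots> = (\<omega> powi r) ^ n * \<epsilon> ^ (2 * n)" by (simp add: power_mult_distrib power_mult)
        also have "(\<omega> powi r) ^ n = (\<omega> ^ n) powi r"
          by (metis mult.commute power_int_mult power_int_of_nat)
        finally show False using elim(5) \<epsilon> \<omega>(1) by simp
      qed
    qed
    then show False by (rule ex_generic)
  qed
qed

lemma forms_imp_good_solution: "good_solution A (half_sum_power n) (half_sum_power n) F"
  unfolding good_solution_def
proof (intro conjI)
  show "nonconstant A"
  proof (rule ccontr)
    assume "\<not> nonconstant A"
    then obtain c where "\<forall>\<^sub>F z in cofinite. rat_eval A z = c"
      using constant_generic[OF represents_eval] by blast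
    from generic_compose[OF finite_fibres_half_sum_power[OF n_pos] this] semiconjugacy
      finite_fibresD[OF finite_fibres_comp[OF finite_fibres_half_sum_power[OF n_pos] F_finite_fibres], of c]
    have "\<forall>\<^sub>F t :: complex in cofinite. False" by eventually_elim simp
    then show False by (rule ex_generic)
  qed
  show P: "nonconstant (half_sum_power n)" "nonconstant (half_sum_power n)"
    using nonconstant_iff_finite_fibres[OF represents_half_sum_power] finite_fibres_half_sum_power[OF n_pos]
    by auto
  show "nonconstant F" by (rule F_nonconstant)
  show "rat_map A \<circ> rat_map (half_sum_power n) = rat_map (half_sum_power n) \<circ> rat_map F"
    using semiconjugacy semiconjugacy_generic[OF n_pos F_nonconstant] by (simp add: f_def)
  show "irreducible_curve A (half_sum_power n)" by (rule curve_irreducible)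
  show "no_common_right_factor (half_sum_power n) F" by (rule no_common_factor)
qed

end


section \<open>Minimal holomorphic maps of the dihedral orbifold\<close>

lemma degree_eq_sum_order:
  fixes p :: "complex poly"
  assumes "p \<noteq> 0"
  shows "degree p = (\<Sum>x | poly p x = 0. order x p)"
proof -
  have "degree p = degree (smult (lead_coeff p) (\<Prod>x | poly p x = 0. [:- x, 1:] ^ order x p))"
    by (simp only: complex_poly_decompose)
  also have "\<dots> = degree (\<Prod>x | poly p x = 0. [:- x, 1:] ^ order x p)"
    using assms by simp
  also have "\<dots> = (\<Sum>x | poly p x = 0. degree ([:- x, 1:] ^ order x p))"
    by (rule degree_prod_sum_eq) simp
  finally show ?thesis by (simp add: degree_power_eq)
qed

lemma poly_product_over_roots:
  fixes p :: "complex poly"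
  shows "poly p y = lead_coeff p * (\<Prod>x | poly p x = 0. (y - x) ^ order x p)"
proof -
  have "poly p y = poly (smult (lead_coeff p) (\<Prod>x | poly p x = 0. [:- x, 1:] ^ order x p)) y"
    by (simp only: complex_poly_decompose)
  then show ?thesis by (simp add: poly_prod)
qed

text \<open>
  A root \<open>x\<close> of \<open>p\<close> contributes the factor \<open>s\<^sup>2 - 2xs + 1 = 2s(J(s) - x)\<close> to the pullback. Over the branch
  points \<open>x = \<plusminus>1\<close> this factor is a square, which is why only twice the order matters there.
\<close>

lemma joukowski_pullback_power:
  fixes p :: "complex poly"
  assumes "p \<noteq> 0" "m > 0"
    and ord: "\<And>x. poly p x = 0 \<Longrightarrow> m dvd 2 * order x p"
      "\<And>x. poly p x = 0 \<Longrightarrow> x \<noteq> 1 \<Longrightarrow> x \<noteq> - 1 \<Longrightarrow> m dvd order x p"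
  obtains w where "poly w 0 \<noteq> 0" "\<And>s. s \<noteq> 0 \<Longrightarrow> poly w s ^ m = (2 * s) ^ degree p * poly p (joukowski s)"
proof -
  define Z where "Z = {x. poly p x = 0}"
  define B where "B x = [:1, - 2 * x, 1:]" for x :: complex
  have evalB: "poly (B x) s = 2 * s * (joukowski s - x)" if "s \<noteq> 0" for x s
    using joukowski_quadratic[OF that] by (simp add: B_def algebra_simps)
  have "\<exists>w. w ^ m = B x ^ order x p" if x: "x \<in> Z" for x
  proof (cases "x = 1 \<or> x = - 1")
    case True
    then have "B x = [:- x, 1:] ^ 2" by (auto simp: B_def power2_eq_square)
    moreover obtain j where "2 * order x p = m * j" using ord(1)[of x] x by (auto simp: Z_def elim: dvdE)
    ultimately have "B x ^ order x p = ([:- x, 1:] ^ j) ^ m"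
      by (metis mult.commute power_mult)
    then show ?thesis by metis
  next
    case False
    then obtain j where "order x p = m * j" using ord(2)[of x] x by (auto simp: Z_def elim: dvdE)
    then have "B x ^ order x p = (B x ^ j) ^ m"
      by (metis mult.commute power_mult)
    then show ?thesis by metis
  qed
  then obtain W where W: "\<And>x. x \<in> Z \<Longrightarrow> W x ^ m = B x ^ order x p" by metis
  obtain c where c: "lead_coeff p = c ^ m" using exists_complex_root[of m "lead_coeff p"] assms(2) by auto
  define w where "w = smult c (\<Prod>x\<in>Z. W x)"
  have "w ^ m = smult (lead_coeff p) (\<Prod>x\<in>Z. B x ^ order x p)"
    unfolding w_def smult_power c prod_power_distrib
    by (rule arg_cong[of _ _ "smult (c ^ m)"], rule prod.cong) (simp_all add: W)
  from arg_cong[OF this, of "\<lambda>q. poly q _"]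
  have eval: "poly w s ^ m = lead_coeff p * (\<Prod>x\<in>Z. poly (B x) s ^ order x p)" for s
    by (simp add: poly_prod)
  have "poly w 0 \<noteq> 0"
    using eval[of 0] assms by (auto simp: B_def power_0_left)
  moreover have "poly w s ^ m = (2 * s) ^ degree p * poly p (joukowski s)" if "s \<noteq> 0" for s
  proof -
    have "poly w s ^ m = lead_coeff p * (\<Prod>x\<in>Z. (2 * s) ^ order x p * (joukowski s - x) ^ order x p)"
      unfolding eval evalB[OF that] power_mult_distrib ..
    also have "\<dots> = (2 * s) ^ (\<Sum>x\<in>Z. order x p) * (lead_coeff p * (\<Prod>x\<in>Z. (joukowski s - x) ^ order x p))"
      by (simp only: prod.distrib power_sum mult.left_commute)
    finally show ?thesis
      using degree_eq_sum_order[OF assms(1)] poly_product_over_roots[of p "joukowski s"]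
      by (simp add: Z_def)
  qed
  ultimately show ?thesis by (rule that)
qed

text \<open>
  A root of \<open>u\<close> is no root of \<open>v\<close>, so its order in \<open>u\<close> is its order in \<open>c\<^sup>n\<close>; the leading coefficient has an
  \<open>n\<close>-th root in the complex numbers.
\<close>

lemma coprime_factor_of_power:
  fixes u v c :: "complex poly"
  assumes "coprime u v" "u * v = c ^ n" "n > 0" "c \<noteq> 0"
  obtains w where "u = w ^ n"
proof -
  have nz: "u * v \<noteq> 0" unfolding assms(2) using assms(4) by simp
  then have "u \<noteq> 0" "v \<noteq> 0" by auto
  obtain a where a: "lead_coeff u = a ^ n" using exists_complex_root[of n "lead_coeff u"] assms(3) by auto
  have ord: "order x u = order x c * n" if "poly u x = 0" for x
  proof -
    have "poly v x \<noteq> 0" using coprime_poly_0[OF assms(1), of x] that by simp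
    then have "order x v = 0" by (rule order_0I)
    then have "order x u = order x (c ^ n)" using order_mult[OF nz, of x] assms(2) by simp
    then show ?thesis by (simp add: order_power assms(4) mult.commute)
  qed
  have "u = smult (lead_coeff u) (\<Prod>x | poly u x = 0. [:- x, 1:] ^ order x u)"
    by (simp only: complex_poly_decompose)
  also have "(\<Prod>x | poly u x = 0. [:- x, 1:] ^ order x u) = (\<Prod>x | poly u x = 0. ([:- x, 1:] ^ order x c) ^ n)"
    by (rule prod.cong) (simp_all add: ord power_mult)
  also have "smult (lead_coeff u) \<dots> = smult a (\<Prod>x | poly u x = 0. [:- x, 1:] ^ order x c) ^ n"
    by (simp only: a smult_power prod_power_distrib)
  finally show ?thesis by (rule that)
qed

context
  fixes n :: nat and A :: ratfun
  assumes n: "n > 2" and min: "minimal_holomorphic_self_map (dihedral_orbifold n) A"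
begin

lemma minimality:
  "dihedral_orbifold n (rat_map A z)
    = dihedral_orbifold n z * gcd (local_degree A z) (dihedral_orbifold n (rat_map A z))"
  using min unfolding minimal_holomorphic_self_map_def by blast

text \<open>
  The ramification at \<open>A(\<infinity>)\<close> is a positive multiple of \<open>n\<close>, and infinity is the only point with ramification
  above \<open>2\<close>. So \<open>A\<close> fixes infinity, and minimality there reads \<open>n = n gcd(k, n)\<close>.
\<close>

lemma minimal_map_at_infinity:
  "degree (rat_den A) < degree (rat_num A)"
  "coprime (degree (rat_num A) - degree (rat_den A)) n"
proof -
  let ?v = "dihedral_orbifold n (rat_map A Infty)"
  have eq: "?v = n * gcd (local_degree A Infty) ?v"
    using minimality[of Infty] by (simp add: dihedral_orbifold_def del: rat_map.simps local_degree.simps)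
  have "?v > 0" using n by (simp add: dihedral_orbifold_def del: rat_map.simps)
  then have "gcd (local_degree A Infty) ?v > 0" by (simp del: rat_map.simps local_degree.simps)
  then have "1 \<le> gcd (local_degree A Infty) ?v" by (simp only: One_nat_def Suc_le_eq)
  then have "n * 1 \<le> n * gcd (local_degree A Infty) ?v" by (rule mult_le_mono2)
  then have "?v > 2" using eq n by linarith
  then have inf: "rat_map A Infty = Infty"
    by (auto simp: dihedral_orbifold_def simp del: rat_map.simps split: if_splits)
  then show deg: "degree (rat_den A) < degree (rat_num A)"
    by (auto split: if_splits)
  have "gcd (local_degree A Infty) n = 1"
    using eq n unfolding inf by (simp add: dihedral_orbifold_def del: local_degree.simps)
  moreover have "local_degree A Infty = degree (rat_num A) - degree (rat_den A)"
    using deg by (simp add: inf rat_degree_def del: rat_map.simps)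
  ultimately show "coprime (degree (rat_num A) - degree (rat_den A)) n"
    by (simp add: coprime_iff_gcd_eq_1)
qed

text \<open>
  At \<open>x = \<plusminus>1\<close> minimality reads \<open>n = 2 gcd(order, n)\<close>, so only twice the order is a multiple of \<open>n\<close>. At
  these two points \<open>joukowski_pullback_power\<close> asks for no more.
\<close>

lemma minimal_map_poles:
  assumes "poly (rat_den A) x = 0"
  shows "n dvd 2 * order x (rat_den A)" "x \<noteq> 1 \<Longrightarrow> x \<noteq> - 1 \<Longrightarrow> n dvd order x (rat_den A)"
proof -
  have inf: "rat_map A (Finite x) = Infty" using assms by simp
  let ?v = "dihedral_orbifold n (Finite x)" and ?g = "gcd (order x (rat_den A)) n"
  have eq: "n = ?v * ?g"
    using minimality[of "Finite x"] unfolding local_degree.simps inf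
    by (simp add: dihedral_orbifold_def[of n Infty])
  show "n dvd order x (rat_den A)" if "x \<noteq> 1" "x \<noteq> - 1"
    using eq that by (metis cp1.inject cp1.distinct(1) dihedral_orbifold_def gcd_dvd1 mult_1)
  then show "n dvd 2 * order x (rat_den A)"
  proof (cases "x = 1 \<or> x = - 1")
    case True
    then have "n = 2 * ?g" using eq by (auto simp: dihedral_orbifold_def)
    then show ?thesis by (metis dvd_refl gcd_dvd1 mult_dvd_mono)
  qed auto
qed

lemma minimal_map_fibres_over_branch_points:
  assumes c: "c = 1 \<or> c = - 1" and x: "poly (rat_num A - smult c (rat_den A)) x = 0" "x \<noteq> 1" "x \<noteq> - 1"
  shows "2 dvd order x (rat_num A - smult c (rat_den A))"
proof -
  have "poly (rat_den A) x \<noteq> 0"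
    using x(1) no_common_zero_rat_num_den[of A x] by auto
  then have val: "rat_map A (Finite x) = Finite c"
    using x(1) by (simp add: rat_eval_def divide_eq_eq)
  have "dihedral_orbifold n (Finite c) = 2" "dihedral_orbifold n (Finite x) = 1"
    using c x(2,3) by (auto simp: dihedral_orbifold_def)
  then have "2 = gcd (order x (rat_num A - smult c (rat_den A))) 2"
    using minimality[of "Finite x"] unfolding local_degree.simps val by simp
  then show ?thesis by (metis gcd_dvd1)
qed

text \<open>
  The polynomials \<open>a\<^sup>2\<close>, \<open>b\<^sup>2\<close> and \<open>C\<^sup>n\<close> are the pullbacks of \<open>N - D\<close>, \<open>N + D\<close> and \<open>D\<close>, for \<open>A = N/D\<close>, cleared of
  denominators. From \<open>N/D = (a\<^sup>2 + b\<^sup>2)/(b\<^sup>2 - a\<^sup>2) = J((b + a)/(b - a))\<close> it remains to see that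
  \<open>(b + a)/(b - a)\<close> is \<open>s\<^sup>k\<close> times an \<open>n\<close>-th power.
\<close>

lemma minimal_map_lift:
  obtains k u v where "coprime k n" "u \<noteq> 0" "v \<noteq> 0"
    "\<forall>\<^sub>F s in cofinite. rat_eval A (joukowski s) = joukowski (s ^ k * (poly u s / poly v s) ^ n)"
proof -
  define N D where "N = rat_num A" and "D = rat_den A"
  define d k where "d = degree N" and "k = degree N - degree D"
  have deg: "degree D < d" and k: "coprime k n"
    using minimal_map_at_infinity by (simp_all add: N_def D_def d_def k_def)
  have dk: "d = k + degree D" and k0: "k > 0" using deg by (simp_all add: k_def d_def)
  have n0: "n > 0" using n by simp
  have D0: "D \<noteq> 0" by (simp add: D_def rat_den_nonzero)
  have degs: "degree (N - smult c D) = d" for c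
    using deg degree_smult_le[of c D] degree_add_eq_left[of "- smult c D" N] by (simp add: d_def)
  have nz: "N - smult c D \<noteq> 0" for c using degs[of c] deg by auto
  obtain C where C: "poly C 0 \<noteq> 0"
    "\<And>s. s \<noteq> 0 \<Longrightarrow> poly C s ^ n = (2 * s) ^ degree D * poly D (joukowski s)"
    using joukowski_pullback_power[OF D0 n0] minimal_map_poles unfolding D_def by metis
  have sqrt: "\<exists>w. poly w 0 \<noteq> 0 \<and> (\<forall>s. s \<noteq> 0 \<longrightarrow> poly w s ^ 2 = (2 * s) ^ d * poly (N - smult c D) (joukowski s))"
    if "c = 1 \<or> c = - 1" for c
    using joukowski_pullback_power[OF nz[of c], of 2] minimal_map_fibres_over_branch_points[OF that]
    unfolding N_def[symmetric] D_def[symmetric] degs by (metis dvd_triv_left zero_less_numeral)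
  obtain a0 where a0: "\<And>s. s \<noteq> 0 \<Longrightarrow> poly a0 s ^ 2 = (2 * s) ^ d * poly (N - smult 1 D) (joukowski s)"
    using sqrt[of 1] by blast
  obtain b where b: "poly b 0 \<noteq> 0"
    "\<And>s. s \<noteq> 0 \<Longrightarrow> poly b s ^ 2 = (2 * s) ^ d * poly (N - smult (- 1) D) (joukowski s)"
    using sqrt[of "- 1"] by blast
  \<comment> \<open>A root of the constant in \<open>b\<^sup>2 - a\<^sup>2 = 2 (2s)\<^sup>k C\<^sup>n\<close>, absorbed into the \<open>n\<close>-th power.\<close>
  obtain e :: complex where e: "2 ^ (k + 1) = e ^ n"
    using exists_complex_root[of n "2 ^ (k + 1)"] n0 by auto
  define E where "E = smult e C"
  have "e \<noteq> 0" using e n0 by (auto simp: power_0_left)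
  moreover have "C \<noteq> 0" using C(1) by auto
  ultimately have "E \<noteq> 0" by (simp add: E_def)
  have diff0: "(b - a0) * (b + a0) = [:0, 1:] ^ k * E ^ n"
  proof (rule poly_eqI_generic)
    show "\<forall>\<^sub>F s in cofinite. poly ((b - a0) * (b + a0)) s = poly ([:0, 1:] ^ k * E ^ n) s"
      using generic_neq[of 0]
    proof eventually_elim
      case (elim s)
      have "poly ((b - a0) * (b + a0)) s = poly b s ^ 2 - poly a0 s ^ 2"
        by (simp add: power2_eq_square algebra_simps)
      also have "\<dots> = 2 * (2 * s) ^ k * ((2 * s) ^ degree D * poly D (joukowski s))"
        unfolding a0[OF elim] b(2)[OF elim] dk power_add by (simp add: algebra_simps)
      also have "\<dots> = s ^ k * (2 ^ (k + 1) * poly C s ^ n)"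
        unfolding C(2)[OF elim] by (simp add: power_mult_distrib)
      also have "\<dots> = poly ([:0, 1:] ^ k * E ^ n) s"
        unfolding e E_def by (simp add: power_mult_distrib)
      finally show ?case .
    qed
  qed
  \<comment> \<open>As \<open>k > 0\<close>, exactly one of \<open>b \<plusminus> a\<^sub>0\<close> vanishes at \<open>0\<close>. The sign of the square root is chosen so
    that the whole factor \<open>s\<^sup>k\<close> lies in \<open>b + a\<close>.\<close>
  have "poly ((b - a0) * (b + a0)) 0 = 0" unfolding diff0 using k0 by simp
  then have "poly (b + a0) 0 = 0 \<or> poly (b + - a0) 0 = 0" by auto
  then obtain a where a_cases: "a = a0 \<or> a = - a0" and ab0: "poly (b + a) 0 = 0" by metis
  have diff: "(b - a) * (b + a) = [:0, 1:] ^ k * E ^ n"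
    using a_cases diff0 by (auto simp: mult.commute)
  have a: "poly a s ^ 2 = (2 * s) ^ d * poly (N - smult 1 D) (joukowski s)" if "s \<noteq> 0" for s
    using a_cases a0[OF that] by auto
  have "poly a 0 = - poly b 0" using ab0 by (simp add: eq_neg_iff_add_eq_0 add.commute)
  then have "poly (b - a) 0 = 2 * poly b 0" by simp
  then have ba0: "poly (b - a) 0 \<noteq> 0" using b(1) by (metis mult_eq_0_iff zero_neq_numeral)
  have cop: "coprime (b - a) (b + a)"
  proof (rule coprime_if_no_common_zero, rule ccontr)
    fix z assume "\<not> (poly (b - a) z \<noteq> 0 \<or> poly (b + a) z \<noteq> 0)"
    then have "poly b z - poly a z = 0" "poly b z + poly a z = 0" by simp_all
    then have z: "poly a z = 0" "poly b z = 0" by algebra+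
    show False
    proof (cases "z = 0")
      case False
      then have "poly (N - smult 1 D) (joukowski z) = 0" "poly (N - smult (- 1) D) (joukowski z) = 0"
        using a[OF False] b(2)[OF False] z by simp_all
      then have "poly N (joukowski z) - poly D (joukowski z) = 0" "poly N (joukowski z) + poly D (joukowski z) = 0"
        by simp_all
      then have "poly N (joukowski z) = 0" "poly D (joukowski z) = 0" by algebra+
      then show False using no_common_zero_rat_num_den[of A "joukowski z"] by (simp add: N_def D_def)
    qed (use z b(1) in simp)
  qed
  have "coprime ([:0, 1:] ^ k) (b - a)"
    by (rule coprime_if_no_common_zero) (use ba0 in \<open>auto\<close>)
  moreover have "[:0, 1:] ^ k dvd (b - a) * (b + a)" unfolding diff by simp
  ultimately have "[:0, 1:] ^ k dvd b + a" by (simp add: coprime_dvd_mult_right_iff)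
  then obtain g where g: "b + a = [:0, 1:] ^ k * g" by (elim dvdE)
  have "[:0, 1:] ^ k * ((b - a) * g) = [:0, 1:] ^ k * E ^ n"
    using diff unfolding g by (simp add: mult.left_commute)
  then have bag: "(b - a) * g = E ^ n" by (simp only: mult_cancel_left) simp
  have "coprime (b - a) g" using cop unfolding g by (simp add: coprime_mult_right_iff)
  then obtain v u where v: "b - a = v ^ n" and u: "g = u ^ n"
    using coprime_factor_of_power[OF _ bag n0 \<open>E \<noteq> 0\<close>]
      coprime_factor_of_power[of g "b - a" E n] bag n0 \<open>E \<noteq> 0\<close>
    by (metis coprime_commute mult.commute)
  have uv0: "u \<noteq> 0" "v \<noteq> 0"
    using bag \<open>E \<noteq> 0\<close> n0 unfolding u v by (auto simp: power_0_left)
  have "\<forall>\<^sub>F s in cofinite. rat_eval A (joukowski s) = joukowski (s ^ k * (poly u s / poly v s) ^ n)"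
    using generic_neq[of 0] generic_poly_nonzero[OF uv0(1)] generic_poly_nonzero[OF uv0(2)]
      generic_compose[OF finite_fibres_joukowski generic_poly_nonzero[OF D0]]
  proof eventually_elim
    case (elim s)
    define x y where "x = poly (b + a) s" and "y = poly (b - a) s"
    have xy: "x = s ^ k * poly u s ^ n" "y = poly v s ^ n"
      by (simp_all add: x_def y_def g u v)
    then have "x \<noteq> 0" "y \<noteq> 0" using elim(1-3) by simp_all
    define t where "t = (2 * s) ^ d"
    have "t \<noteq> 0" using elim(1) by (simp add: t_def)
    define P Q where "P = poly N (joukowski s)" and "Q = poly D (joukowski s)"
    have "Q \<noteq> 0" using elim(4) by (simp add: Q_def)
    have "poly a s ^ 2 = t * (P - Q)" "poly b s ^ 2 = t * (P + Q)"
      using a[OF elim(1)] b(2)[OF elim(1)] by (simp_all add: t_def P_def Q_def)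
    moreover have "x = poly b s + poly a s" "y = poly b s - poly a s"
      by (simp_all add: x_def y_def)
    ultimately have "x * y = 2 * t * Q" "x * x + y * y = 4 * t * P" by algebra+
    then have "t * (2 * P * (x * y)) = t * (Q * (x * x + y * y))" by algebra
    then have PQ: "2 * P * (x * y) = Q * (x * x + y * y)" using \<open>t \<noteq> 0\<close> by simp
    have "P / Q = (x * x + y * y) / (2 * (x * y))"
      using PQ \<open>Q \<noteq> 0\<close> \<open>x \<noteq> 0\<close> \<open>y \<noteq> 0\<close> by (simp add: frac_eq_eq ac_simps)
    also have "\<dots> = joukowski (x / y)"
      using \<open>x \<noteq> 0\<close> \<open>y \<noteq> 0\<close> by (simp add: joukowski_def add_divide_distrib mult.commute)
    also have "x / y = s ^ k * (poly u s / poly v s) ^ n"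
      by (simp add: xy power_divide)
    finally show ?case by (simp add: rat_eval_def P_def Q_def N_def D_def)
  qed
  with k uv0 show ?thesis by (rule that)
qed

lemma minimal_map_imp_A_form:
  "\<exists>R \<in> commuting_with_inversion. \<exists>(r :: int) \<epsilon>. gcd r (int n) = 1 \<and> \<epsilon> ^ (2 * n) = 1 \<and> A_form n \<epsilon> r R A"
proof -
  obtain k u v where kuv: "coprime k n" "u \<noteq> 0" "v \<noteq> 0"
    "\<forall>\<^sub>F s in cofinite. rat_eval A (joukowski s) = joukowski (s ^ k * (poly u s / poly v s) ^ n)"
    using minimal_map_lift .
  have "Fraction_Field.Fract u v \<noteq> 0" using kuv(2,3) by (simp add: Zero_fract_def eq_fract)
  from joukowski_lift_classification[OF n kuv(1) represents_Fract[OF kuv(3)] this kuv(4)]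
  obtain R \<epsilon> where R: "R \<in> commuting_with_inversion" "\<epsilon> ^ (2 * n) = 1" "A_form n \<epsilon> (int k) R A"
    by blast
  moreover have "gcd (int k) (int n) = 1"
    using kuv(1) by (metis coprime_iff_gcd_eq_1 gcd_int_int_eq of_nat_1)
  ultimately show ?thesis
    by (intro bexI[of _ R] exI[of _ "int k"] exI[of _ \<epsilon>] conjI)
qed

end


section \<open>The classification\<close>

theorem theorem5p4:
  fixes n :: nat
  assumes "n > 2"
  shows "(\<forall>A F :: ratfun.
            good_solution A (half_sum_power n) (half_sum_power n) F \<longleftrightarrow>
            (\<exists>R \<in> commuting_with_inversion. \<exists>(r :: int) (\<epsilon> :: complex).
               gcd r (int n) = 1 \<and> \<epsilon> ^ (2 * n) = 1 \<and> F_form n \<epsilon> r R F \<and> A_form n \<epsilon> r R A))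
       \<and> (\<forall>A :: ratfun.
            minimal_holomorphic_self_map (dihedral_orbifold n) A \<longrightarrow>
            (\<exists>R \<in> commuting_with_inversion. \<exists>(r :: int) (\<epsilon> :: complex).
               gcd r (int n) = 1 \<and> \<epsilon> ^ (2 * n) = 1 \<and> A_form n \<epsilon> r R A))"
proof (intro conjI allI impI iffI)
  fix A F :: ratfun
  assume "good_solution A (half_sum_power n) (half_sum_power n) F"
  then show "\<exists>R \<in> commuting_with_inversion. \<exists>(r :: int) (\<epsilon> :: complex).
      gcd r (int n) = 1 \<and> \<epsilon> ^ (2 * n) = 1 \<and> F_form n \<epsilon> r R F \<and> A_form n \<epsilon> r R A"
    by (rule good_solution_imp_forms[OF assms])
next
  fix A F :: ratfun
  assume "\<exists>R \<in> commuting_with_inversion. \<exists>(r :: int) (\<epsilon> :: complex).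
      gcd r (int n) = 1 \<and> \<epsilon> ^ (2 * n) = 1 \<and> F_form n \<epsilon> r R F \<and> A_form n \<epsilon> r R A"
  then show "good_solution A (half_sum_power n) (half_sum_power n) F"
    by (elim bexE exE conjE) (rule forms_imp_good_solution[OF assms])
next
  fix A :: ratfun
  assume "minimal_holomorphic_self_map (dihedral_orbifold n) A"
  then show "\<exists>R \<in> commuting_with_inversion. \<exists>(r :: int) (\<epsilon> :: complex).
      gcd r (int n) = 1 \<and> \<epsilon> ^ (2 * n) = 1 \<and> A_form n \<epsilon> r R A"
    by (rule minimal_map_imp_A_form[OF assms])
qed

end
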